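(* Let $q\ge 3$ be an integer. (1) For every $\sigma,\delta\ge 1$, $q$-Coloring on $n$-vertex graphs can be solved in time $q^{p}\cdot n^{\mathcal{O}(1)}$ if a $(\sigma,\delta)$-hub of size $p$ is given in the input. (2) For every $\epsilon>0$, there exist integers $\sigma,\delta\ge 1$ such that if there is an algorithm solving in time $(q-\epsilon)^{p}\cdot n^{\mathcal{O}(1)}$ every $n$-vertex instance of $q$-Coloring given with a $(\sigma,\delta)$-hub of size at most $p$, then the SETH fails.
   Context: For a graph $G$ and integers $\sigma,\delta\ge 1$, a set $Q\subseteq V(G)$ is a $(\sigma,\delta)$-hub of $G$ if every connected component of $G-Q$ has at most $\sigma$ vertices and each such component is adjacent (in $G$) to at most $\delta$ vertices of $Q$. $q$-Coloring: given a graph $G$, decide whether there is a map $V(G)\to[q]$, $[q]=\{1,\dots,q\}$, such that adjacent vertices receive different colors. The Strong Exponential-Time Hypothesis (SETH): there is no $\epsilon>0$ such that for every $k$, every $n$-variable instance of $k$-SAT can be solved in time $(2-\epsilon)^n\cdot n^{\mathcal{O}(1)}$. *)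

theory Defs
  imports Complex_Main
begin

section \<open>Algorithms and running time\<close>

text \<open>
  Algorithms are programs of the WHILE language over binary trees (N. D. Jones, \<^emph>\<open>Computability
  and Complexity from a Programming Perspective\<close>) at unit cost per elementary operation. Every
  operation reads or allocates a bounded number of pointers, and a random-access machine with
  words of logarithmic size and this language simulate each other with a factor
  polylogarithmic in the running time and the input size. For running times
  \<open>2\<^bsup>poly(n)\<^esup>\<close> this is a factor \<open>n\<^bsup>O(1)\<^esup>\<close>, so the bounds
  \<open>b\<^bsup>p\<^esup> \<cdot> n\<^bsup>O(1)\<^esup>\<close> below do not depend on which of the two models is used.
\<close>

datatype val = Nl | Pr val val

fun vhd :: "val \<Rightarrow> val" where
  "vhd Nl = Nl"
| "vhd (Pr a b) = a"

fun vtl :: "val \<Rightarrow> val" where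
  "vtl Nl = Nl"
| "vtl (Pr a b) = b"

datatype exp = EVar nat | ENil | ECons exp exp | EHd exp | ETl exp

type_synonym state = "nat \<Rightarrow> val"

fun eval_exp :: "exp \<Rightarrow> state \<Rightarrow> val" where
  "eval_exp (EVar x) s = s x"
| "eval_exp ENil s = Nl"
| "eval_exp (ECons e f) s = Pr (eval_exp e s) (eval_exp f s)"
| "eval_exp (EHd e) s = vhd (eval_exp e s)"
| "eval_exp (ETl e) s = vtl (eval_exp e s)"

fun exp_cost :: "exp \<Rightarrow> nat" where
  "exp_cost (EVar x) = 1"
| "exp_cost ENil = 1"
| "exp_cost (ECons e f) = 1 + exp_cost e + exp_cost f"
| "exp_cost (EHd e) = 1 + exp_cost e"
| "exp_cost (ETl e) = 1 + exp_cost e"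

datatype com = Skip | Assign nat exp | Seq com com | If exp com com | While exp com

text \<open>\<open>exec c s t s'\<close>: started in state \<open>s\<close>, the program \<open>c\<close> halts in state \<open>s'\<close> after \<open>t\<close> steps.
  A test succeeds iff its value is not the empty tree.\<close>

inductive exec :: "com \<Rightarrow> state \<Rightarrow> nat \<Rightarrow> state \<Rightarrow> bool" where
  Skip: "exec Skip s 1 s"
| Assign: "exec (Assign x e) s (1 + exp_cost e) (s(x := eval_exp e s))"
| Seq: "exec c1 s1 t1 s2 \<Longrightarrow> exec c2 s2 t2 s3 \<Longrightarrow> exec (Seq c1 c2) s1 (t1 + t2) s3"
| IfTrue: "eval_exp e s \<noteq> Nl \<Longrightarrow> exec c1 s t s' \<Longrightarrow> exec (If e c1 c2) s (1 + exp_cost e + t) s'"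
| IfFalse: "eval_exp e s = Nl \<Longrightarrow> exec c2 s t s' \<Longrightarrow> exec (If e c1 c2) s (1 + exp_cost e + t) s'"
| WhileFalse: "eval_exp e s = Nl \<Longrightarrow> exec (While e c) s (1 + exp_cost e) s"
| WhileTrue: "eval_exp e s1 \<noteq> Nl \<Longrightarrow> exec c s1 t1 s2 \<Longrightarrow> exec (While e c) s2 t2 s3 \<Longrightarrow>
    exec (While e c) s1 (1 + exp_cost e + t1 + t2) s3"

inductive_cases exec_SkipE: "exec Skip s t s'"
inductive_cases exec_AssignE: "exec (Assign x e) s t s'"
inductive_cases exec_SeqE: "exec (Seq c1 c2) s t s'"
inductive_cases exec_IfE: "exec (If e c1 c2) s t s'"
inductive_cases exec_WhileE: "exec (While e c) s t s'"

lemma exec_deterministic: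
  "exec c s t s' \<Longrightarrow> exec c s t' s'' \<Longrightarrow> t' = t \<and> s'' = s'"
proof (induction arbitrary: t' s'' rule: exec.induct)
  case (Skip s)
  from Skip.prems show ?case by (rule exec_SkipE) simp
next
  case (Assign x e s)
  from Assign.prems show ?case by (rule exec_AssignE) simp
next
  case (Seq c1 s1 t1 s2 c2 t2 s3)
  from Seq.prems show ?case by (rule exec_SeqE) (auto dest!: Seq.IH)
next
  case (IfTrue e s c1 t s' c2)
  from IfTrue.prems show ?case by (rule exec_IfE) (use IfTrue.hyps in \<open>auto dest!: IfTrue.IH\<close>)+
next
  case (IfFalse e s c2 t s' c1)
  from IfFalse.prems show ?case by (rule exec_IfE) (use IfFalse.hyps in \<open>auto dest!: IfFalse.IH\<close>)+
next
  case (WhileFalse e s c)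
  from WhileFalse.prems show ?case by (rule exec_WhileE) (use WhileFalse.hyps in \<open>auto\<close>)+
next
  case (WhileTrue e s1 c t1 s2 t2 s3)
  from WhileTrue.prems show ?case by (rule exec_WhileE) (use WhileTrue.hyps in \<open>auto dest!: WhileTrue.IH\<close>)+
qed

lemma exec_time_pos: "exec c s t s' \<Longrightarrow> 1 \<le> t"
  by (induction rule: exec.induct) auto

fun enc_bool :: "bool \<Rightarrow> val" where
  "enc_bool False = Nl"
| "enc_bool True = Pr Nl Nl"

fun enc_nat :: "nat \<Rightarrow> val" where
  "enc_nat 0 = Nl"
| "enc_nat (Suc n) = Pr Nl (enc_nat n)"

fun enc_list :: "('a \<Rightarrow> val) \<Rightarrow> 'a list \<Rightarrow> val" where
  "enc_list f [] = Nl"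
| "enc_list f (x # xs) = Pr (f x) (enc_list f xs)"

text \<open>Input and output are passed in variable \<open>0\<close>; all other variables are initially empty.\<close>

definition decides_within :: "com \<Rightarrow> val \<Rightarrow> bool \<Rightarrow> real \<Rightarrow> bool" where
  "decides_within prog inp answer T \<longleftrightarrow>
     (\<exists>t s. exec prog ((\<lambda>_. Nl)(0 := inp)) t s \<and> s 0 = enc_bool answer \<and> real t \<le> T)"

section \<open>Graphs, hubs and colorings\<close>

definition simple_graph :: "'a set \<Rightarrow> ('a \<times> 'a) set \<Rightarrow> bool" where
  "simple_graph V E \<longleftrightarrow> finite V \<and> E \<subseteq> V \<times> V \<and> sym E \<and> irrefl E"

text \<open>Vertex sets of the connected components of the subgraph induced by \<open>W\<close>.\<close>

definition components_on :: "'a set \<Rightarrow> ('a \<times> 'a) set \<Rightarrow> 'a set set" where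
  "components_on W E = W // {(u, v). u \<in> W \<and> v \<in> W \<and> (u, v) \<in> (E \<inter> W \<times> W)\<^sup>*}"

definition is_hub :: "nat \<Rightarrow> nat \<Rightarrow> 'a set \<Rightarrow> ('a \<times> 'a) set \<Rightarrow> 'a set \<Rightarrow> bool" where
  "is_hub \<sigma> \<delta> V E Q \<longleftrightarrow> Q \<subseteq> V \<and>
     (\<forall>C \<in> components_on (V - Q) E.
        card C \<le> \<sigma> \<and> card {v \<in> Q. \<exists>u \<in> C. (u, v) \<in> E} \<le> \<delta>)"

definition colorable :: "nat \<Rightarrow> 'a set \<Rightarrow> ('a \<times> 'a) set \<Rightarrow> bool" where
  "colorable q V E \<longleftrightarrow>
     (\<exists>f :: 'a \<Rightarrow> nat. (\<forall>v \<in> V. f v \<in> {1..q}) \<and> (\<forall>(u, v) \<in> E. f u \<noteq> f v))"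

text \<open>A graph on the vertices \<open>0, \<dots>, n - 1\<close> is given by its adjacency matrix, and the hub by its
  characteristic vector.\<close>

definition enc_graph_hub :: "nat \<Rightarrow> (nat \<times> nat) set \<Rightarrow> nat set \<Rightarrow> val" where
  "enc_graph_hub n E Q =
     Pr (enc_list (\<lambda>u. enc_list (\<lambda>v. enc_bool ((u, v) \<in> E)) [0..<n]) [0..<n])
        (enc_list (\<lambda>v. enc_bool (v \<in> Q)) [0..<n])"

section \<open>The Strong Exponential-Time Hypothesis\<close>

text \<open>The literal \<open>(x, True)\<close> is the variable \<open>x\<close>, and \<open>(x, False)\<close> is its negation.\<close>

type_synonym cnf = "(nat \<times> bool) list list"

definition cnf_satisfiable :: "cnf \<Rightarrow> bool" where
  "cnf_satisfiable \<phi> \<longleftrightarrow>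
     (\<exists>a :: nat \<Rightarrow> bool. \<forall>C \<in> set \<phi>. \<exists>(x, b) \<in> set C. a x = b)"

text \<open>Clauses are not repeated: this keeps the size of an instance polynomial in the number of
  variables for fixed \<open>k\<close>, as a time bound in terms of \<open>n\<close> alone requires.\<close>

definition ksat_instance :: "nat \<Rightarrow> nat \<Rightarrow> cnf \<Rightarrow> bool" where
  "ksat_instance k n \<phi> \<longleftrightarrow>
     distinct \<phi> \<and> (\<forall>C \<in> set \<phi>. length C \<le> k \<and> (\<forall>(x, b) \<in> set C. x < n))"

definition enc_cnf :: "nat \<Rightarrow> cnf \<Rightarrow> val" where
  "enc_cnf n \<phi> =
     Pr (enc_nat n) (enc_list (enc_list (\<lambda>(x, b). Pr (enc_nat x) (enc_bool b))) \<phi>)"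

text \<open>The factor \<open>n\<^bsup>O(1)\<^esup>\<close> is written \<open>c * (n + 1) ^ d\<close>, so that it is positive also for \<open>n = 0\<close>.\<close>

definition SETH :: bool where
  "SETH \<longleftrightarrow> \<not> (\<exists>\<epsilon>::real. \<epsilon> > 0 \<and>
     (\<forall>k. \<exists>prog (c::nat) (d::nat). \<forall>n \<phi>. ksat_instance k n \<phi> \<longrightarrow>
        decides_within prog (enc_cnf n \<phi>) (cnf_satisfiable \<phi>)
          ((2 - \<epsilon>) ^ n * (real c * real (n + 1) ^ d))))"

end

theory Submission
  imports Defs
begin

text \<open>
  A coloring of the hub extends to the whole graph iff it extends to every set of at most \<open>\<sigma>\<close>
  further vertices, and there are only polynomially many such sets. Trying all \<open>q\<^bsup>p\<^esup>\<close> colorings of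
  the hub therefore gives the algorithm.

  For the lower bound let \<open>r < q\<close> be the base of the assumed running time and choose \<open>t\<close> and \<open>g\<close> with
  \<open>r\<^bsup>t\<^esup> < 2\<^bsup>g\<^esup> \<le> q\<^bsup>t\<^esup>\<close>. Encode every block of \<open>g\<close> Boolean variables by the colors of \<open>t\<close> hub vertices.
  A clause with \<open>k\<close> literals forbids a bounded number of color patterns on \<open>k t\<close> hub vertices, and each
  pattern is forbidden by a gadget of bounded size attached to these vertices and to a clique that
  names the colors. The hub has about \<open>n t / g\<close> vertices, so \<open>k\<close>-SAT is solved with base
  \<open>r\<^bsup>t / g\<^esup> < 2\<close>, which does not depend on \<open>k\<close>. As \<open>\<sigma>\<close> and \<open>\<delta>\<close> do depend on \<open>k\<close>, they are chosen
  after the \<open>k\<close> that the SETH provides for this base; if the SETH fails, there is nothing to prove.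
\<close>


section \<open>Polynomial-time computable functions\<close>

subsection \<open>Frame property and program states\<close>

text \<open>\<open>decides_within\<close> speaks of concrete programs. To avoid writing them by
  hand, encodable HOL functions form a class \<open>ptime\<close>, closed under composition,
  pairing, branching and folds; algorithm and reduction are phrased so that these closure rules
  apply. Only the loop over all colorings of the hub lies outside the class, so its number of rounds
  is accounted for separately. In the lower bound, one vertex has \<open>q\<close> colors, which is
  in general no power of 2, and rounding down at every vertex would lose too much. Rounding once per
  block of \<open>t\<close> vertices loses less than a factor 2, and \<open>t\<close> is chosen so
  large that the gap between \<open>r ^ t\<close> and \<open>q ^ t\<close> absorbs it. The gadgets
  are naturally list colorings, with lists enforced by edges to a clique whose vertices name the
  colors. This clique must belong to the hub: outside of it, it would join all gadgets into one
  large component. It adds \<open>q\<close> hub vertices and thus only a constant factor to the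
  running time.\<close>

fun exp_vars :: "exp \<Rightarrow> nat set" where
  "exp_vars (EVar x) = {x}"
| "exp_vars ENil = {}"
| "exp_vars (ECons e f) = exp_vars e \<union> exp_vars f"
| "exp_vars (EHd e) = exp_vars e"
| "exp_vars (ETl e) = exp_vars e"

fun com_vars :: "com \<Rightarrow> nat set" where
  "com_vars Skip = {}"
| "com_vars (Assign x e) = insert x (exp_vars e)"
| "com_vars (Seq c d) = com_vars c \<union> com_vars d"
| "com_vars (If e c d) = exp_vars e \<union> com_vars c \<union> com_vars d"
| "com_vars (While e c) = exp_vars e \<union> com_vars c"

lemma finite_exp_vars [simp]: "finite (exp_vars e)"
  by (induction e) auto

lemma finite_com_vars [simp]: "finite (com_vars c)"
  by (induction c) auto

definition merge :: "nat set \<Rightarrow> state \<Rightarrow> state \<Rightarrow> state" where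
  "merge X s r = (\<lambda>x. if x \<in> X then s x else r x)"

lemma eval_exp_merge: "exp_vars e \<subseteq> X \<Longrightarrow> eval_exp e (merge X s r) = eval_exp e s"
  by (induction e) (auto simp: merge_def)

lemma exec_merge: "exec c s t s' \<Longrightarrow> com_vars c \<subseteq> X \<Longrightarrow> exec c (merge X s r) t (merge X s' r)"
proof (induction rule: exec.induct)
  case (Assign x e s)
  have "merge X (s(x := eval_exp e s)) r = (merge X s r)(x := eval_exp e (merge X s r))"
    using Assign by (subst eval_exp_merge) (auto simp: merge_def)
  then show ?case
    by (simp only: exec.Assign)
next
  case Skip
  show ?case by (rule exec.Skip)
next
  case Seq
  then show ?case by (auto intro: exec.Seq)
next
  case IfTrue
  then show ?case by (intro exec.IfTrue) (auto simp: eval_exp_merge)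
next
  case IfFalse
  then show ?case by (intro exec.IfFalse) (auto simp: eval_exp_merge)
next
  case WhileFalse
  then show ?case by (intro exec.WhileFalse) (auto simp: eval_exp_merge)
next
  case WhileTrue
  then show ?case by (intro exec.WhileTrue) (auto simp: eval_exp_merge)
qed

definition init_state :: "val \<Rightarrow> state" where
  "init_state v = (\<lambda>_. Nl)(0 := v)"

lemma init_state_0 [simp]: "init_state v 0 = v"
  by (simp add: init_state_def)

lemma init_state_upd [simp]: "(init_state v)(0 := w) = init_state w"
  by (simp add: init_state_def)

lemma exec_AssignI:
  "t = 1 + exp_cost e \<Longrightarrow> s' = s(x := eval_exp e s) \<Longrightarrow> exec (Assign x e) s t s'"
  by (simp only: exec.Assign)

text \<open>Lets a program that uses only variables below \<open>k\<close> run as a subroutine while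
  the caller keeps values in the variables from \<open>k\<close> on.\<close>

lemma exec_frame:
  assumes "exec c (init_state v) t (init_state w)" "\<forall>y \<in> com_vars c. y < k" "0 < k" "\<forall>x < k. r x = Nl"
  shows "exec c (r(0 := v)) t (r(0 := w))"
proof -
  have "merge {..<k} (init_state u) r = r(0 := u)" for u
    using assms by (auto simp: merge_def init_state_def)
  with exec_merge[OF assms(1), of "{..<k}" r] assms(2) show ?thesis
    by auto
qed

subsection \<open>Representable types and polynomial bounds\<close>

text \<open>A type class makes the encodings of nested pairs and lists compose by type inference, so
  running times can be stated for HOL functions directly.\<close>

class repr =
  fixes repr :: "'a \<Rightarrow> val"

instantiation val :: repr
begin
definition "repr_val = (\<lambda>v :: val. v)"
instance ..
end

instantiation bool :: repr
begin
definition "repr_bool = enc_bool"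
instance ..
end

instantiation nat :: repr
begin
definition "repr_nat = enc_nat"
instance ..
end

instantiation list :: (repr) repr
begin
definition "repr_list = enc_list (repr :: 'a \<Rightarrow> val)"
instance ..
end

instantiation prod :: (repr, repr) repr
begin
definition "repr_prod = (\<lambda>(a :: 'a, b :: 'b). Pr (repr a) (repr b))"
instance ..
end

lemma repr_simps [simp]:
  "repr (v :: val) = v"
  "repr False = Nl" "repr True = Pr Nl Nl"
  "repr (0 :: nat) = Nl" "repr (Suc n) = Pr Nl (repr n)"
  "repr ([] :: 'a :: repr list) = Nl" "repr (x # xs) = Pr (repr x) (repr (xs :: 'a list))"
  "repr (a, b) = Pr (repr a) (repr (b :: 'b :: repr))"
  by (auto simp: repr_val_def repr_bool_def repr_nat_def repr_list_def repr_prod_def)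

lemma repr_pair: "repr p = Pr (repr (fst p)) (repr (snd p))"
  by (cases p) simp

text \<open>Counts the \<open>Pr\<close> nodes only; with unary numbers this gives a natural number
  its own value as size.\<close>

definition sz :: "'a :: repr \<Rightarrow> nat" where
  "sz x = size (repr x)"

lemma sz_simps [simp]:
  "sz False = 0" "sz True = 1" "sz (n :: nat) = n"
  "sz ([] :: 'a list) = 0" "sz ((x :: 'a :: repr) # xs) = Suc (sz x + sz xs)"
  "sz (x, y :: 'b :: repr) = Suc (sz x + sz y)"
  by (induction n) (auto simp: sz_def)

lemma sz_bool_le: "sz (b :: bool) \<le> 1"
  by (cases b) auto

lemma sz_pair: "sz p = Suc (sz (fst p) + sz (snd p))"
  by (cases p) simp

lemma sz_append [simp]: "sz (xs @ ys) = sz xs + sz (ys :: 'a :: repr list)"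
  by (induction xs) auto

lemma length_le_sz: "length xs \<le> sz (xs :: 'a :: repr list)"
  by (induction xs) auto

lemma sz_member: "x \<in> set xs \<Longrightarrow> sz x < sz (xs :: 'a :: repr list)"
  by (induction xs) (auto simp: less_Suc_eq_le intro: trans_le_add2 less_imp_le)

lemma sz_list_le:
  assumes "\<And>x. x \<in> set xs \<Longrightarrow> sz x \<le> b"
  shows "sz (xs :: 'a :: repr list) \<le> length xs * Suc b"
  using assms
proof (induction xs)
  case (Cons a xs)
  then have "sz a \<le> b" "sz xs \<le> length xs * Suc b"
    by auto
  then show ?case by simp
qed simp

lemma sz_drop_le: "sz (drop i xs) \<le> sz (xs :: 'a :: repr list)"
proof -
  have "sz xs = sz (take i xs) + sz (drop i xs)"
    by (metis append_take_drop_id sz_append)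
  then show ?thesis by simp
qed

text \<open>The \<open>+ 1\<close> keeps the base at least 1, so that exponents may be raised freely
  when bounds are added.\<close>

definition pbounded :: "('a :: repr \<Rightarrow> nat) \<Rightarrow> bool" where
  "pbounded h \<longleftrightarrow> (\<exists>c d. \<forall>x. h x \<le> c * (sz x + 1) ^ d)"

lemma pboundedI: "(\<And>x. h x \<le> c * (sz x + 1) ^ d) \<Longrightarrow> pbounded h"
  unfolding pbounded_def by blast

lemma pbounded_mono: "pbounded h \<Longrightarrow> (\<And>x. g x \<le> h x) \<Longrightarrow> pbounded g"
  unfolding pbounded_def by (meson order_trans)

lemma pbounded_const: "pbounded (\<lambda>_. c)"
  by (rule pboundedI[of _ c 0]) simp

lemma pbounded_sz: "pbounded sz"
  by (rule pboundedI[of _ 1 1]) simp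

lemma pbounded_add:
  assumes "pbounded g" "pbounded h"
  shows "pbounded (\<lambda>x. g x + h x)"
proof -
  obtain c d c' d' where *: "\<And>x. g x \<le> c * (sz x + 1) ^ d" "\<And>x. h x \<le> c' * (sz x + 1) ^ d'"
    using assms unfolding pbounded_def by blast
  show ?thesis
  proof (rule pboundedI[of _ "c + c'" "d + d'"])
    fix x :: 'a
    have "g x \<le> c * (sz x + 1) ^ (d + d')"
      by (rule order_trans[OF *(1)]) (simp add: power_increasing)
    moreover have "h x \<le> c' * (sz x + 1) ^ (d + d')"
      by (rule order_trans[OF *(2)]) (simp add: power_increasing)
    ultimately show "g x + h x \<le> (c + c') * (sz x + 1) ^ (d + d')"
      by (simp add: distrib_right)
  qed
qed

lemma pbounded_mult:
  assumes "pbounded g" "pbounded h"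
  shows "pbounded (\<lambda>x. g x * h x)"
proof -
  obtain c d c' d' where *: "\<And>x. g x \<le> c * (sz x + 1) ^ d" "\<And>x. h x \<le> c' * (sz x + 1) ^ d'"
    using assms unfolding pbounded_def by blast
  show ?thesis
  proof (rule pboundedI[of _ "c * c'" "d + d'"])
    fix x :: 'a
    show "g x * h x \<le> c * c' * (sz x + 1) ^ (d + d')"
      using mult_le_mono[OF *(1)[of x] *(2)[of x]] by (simp add: power_add mult_ac)
  qed
qed

lemma pbounded_power: "pbounded g \<Longrightarrow> pbounded (\<lambda>x. g x ^ d)"
  by (induction d) (auto intro: pbounded_const pbounded_mult)

lemma pbounded_comp:
  assumes "pbounded h" "pbounded (\<lambda>x. sz (f x))"
  shows "pbounded (\<lambda>x. h (f x))"
proof -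
  obtain c d where *: "\<And>x. h x \<le> c * (sz x + 1) ^ d"
    using assms unfolding pbounded_def by blast
  have "pbounded (\<lambda>x. c * (sz (f x) + 1) ^ d)"
    by (intro pbounded_mult pbounded_power pbounded_add pbounded_const assms(2))
  then show ?thesis
    by (rule pbounded_mono) (rule *)
qed

text \<open>The final state is again of the form \<open>init_state\<close>: all auxiliary variables
  are emptied. Hence programs can be put in sequence without any bookkeeping.\<close>

definition computes :: "com \<Rightarrow> ('a :: repr \<Rightarrow> nat) \<Rightarrow> ('a \<Rightarrow> 'b :: repr) \<Rightarrow> bool" where
  "computes p T f \<longleftrightarrow> (\<forall>x. \<exists>t \<le> T x. exec p (init_state (repr x)) t (init_state (repr (f x))))"

text \<open>The size of the output needs a bound of its own. A unit-cost \<open>ECons\<close> of a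
  variable with itself doubles a tree, so a short run can produce a tree of exponential
  size.\<close>

definition ptime :: "('a :: repr \<Rightarrow> 'b :: repr) \<Rightarrow> bool" where
  "ptime f \<longleftrightarrow> pbounded (\<lambda>x. sz (f x)) \<and> (\<exists>p T. pbounded T \<and> computes p T f)"

lemma computesE:
  assumes "computes p T f"
  obtains t where "t \<le> T x" "exec p (init_state (repr x)) t (init_state (repr (f x)))"
  using assms unfolding computes_def by blast

lemma ptimeE:
  assumes "ptime f"
  obtains p T where "pbounded T" "computes p T f"
  using assms unfolding ptime_def by blast

lemma ptimeI:
  assumes "pbounded (\<lambda>x. sz (f x))" "pbounded T"
    "\<And>x. \<exists>t \<le> T x. exec p (init_state (repr x)) t (init_state (repr (f x)))"
  shows "ptime f"
  using assms unfolding ptime_def computes_def by blast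

lemma ptime_pbounded: "ptime f \<Longrightarrow> pbounded (\<lambda>x. sz (f x))"
  by (simp add: ptime_def)

lemma ptime_exp:
  assumes "\<And>x. eval_exp e (init_state (repr x)) = repr (f x)" "pbounded (\<lambda>x. sz (f x))"
  shows "ptime f"
proof (rule ptimeI[OF assms(2) pbounded_const[of "1 + exp_cost e"], of "Assign 0 e"])
  fix x
  have "exec (Assign 0 e) (init_state (repr x)) (1 + exp_cost e) (init_state (repr (f x)))"
    using exec.Assign[of 0 e "init_state (repr x)"] by (simp add: assms(1))
  then show "\<exists>t \<le> 1 + exp_cost e. exec (Assign 0 e) (init_state (repr x)) t (init_state (repr (f x)))"
    by blast
qed

lemma ptime_ident: "ptime (\<lambda>x. x)"
  by (rule ptime_exp[of "EVar 0"]) (auto intro: pbounded_sz)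

lemma ptime_comp:
  assumes "ptime g" "ptime f"
  shows "ptime (\<lambda>x. g (f x))"
proof -
  obtain p T where f: "pbounded T" "computes p T f"
    using assms(2) by (blast elim: ptimeE)
  obtain p' T' where g: "pbounded T'" "computes p' T' g"
    using assms(1) by (blast elim: ptimeE)
  show ?thesis
  proof (rule ptimeI[of _ "\<lambda>x. T x + T' (f x)" "Seq p p'"])
    show "pbounded (\<lambda>x. sz (g (f x)))"
      by (intro pbounded_comp[of "\<lambda>y. sz (g y)" f] ptime_pbounded assms)
    show "pbounded (\<lambda>x. T x + T' (f x))"
      by (intro pbounded_add f g pbounded_comp[of T' f] ptime_pbounded assms)
    fix x
    obtain t where t: "t \<le> T x" "exec p (init_state (repr x)) t (init_state (repr (f x)))"
      by (rule computesE[OF f(2)])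
    obtain t' where t': "t' \<le> T' (f x)" "exec p' (init_state (repr (f x))) t' (init_state (repr (g (f x))))"
      by (rule computesE[OF g(2)])
    show "\<exists>t \<le> T x + T' (f x). exec (Seq p p') (init_state (repr x)) t (init_state (repr (g (f x))))"
      using exec.Seq[OF t(2) t'(2)] add_mono[OF t(1) t'(1)] by blast
  qed
qed

fun val_exp :: "val \<Rightarrow> exp" where
  "val_exp Nl = ENil"
| "val_exp (Pr a b) = ECons (val_exp a) (val_exp b)"

lemma eval_val_exp [simp]: "eval_exp (val_exp v) s = v"
  by (induction v) auto

lemma ptime_const: "ptime (\<lambda>_. c)"
  by (rule ptime_exp[of "val_exp (repr c)"]) (auto intro: pbounded_const)

lemma ptime_fst_basic: "ptime fst"
proof (rule ptime_exp[of "EHd (EVar 0)"])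
  show "pbounded (\<lambda>x :: 'a \<times> 'b. sz (fst x))"
    by (rule pbounded_mono[OF pbounded_sz]) (simp add: sz_pair)
qed (simp add: repr_pair)

lemma ptime_snd_basic: "ptime snd"
proof (rule ptime_exp[of "ETl (EVar 0)"])
  show "pbounded (\<lambda>x :: 'a \<times> 'b. sz (snd x))"
    by (rule pbounded_mono[OF pbounded_sz]) (simp add: sz_pair)
qed (simp add: repr_pair)

lemmas ptime_fst = ptime_comp[OF ptime_fst_basic]
lemmas ptime_snd = ptime_comp[OF ptime_snd_basic]

text \<open>Only the encoding matters, so a change of type is free. This turns pairing into
  \<open>Cons\<close> and \<open>Suc\<close>, and numbers into lists of \<open>Nl\<close>.\<close>

lemma ptime_same_repr:
  assumes "ptime f" "\<And>x. repr (g x) = repr (f x)"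
  shows "ptime g"
  using assms unfolding ptime_def computes_def sz_def by simp

lemma ptime_Pair:
  assumes "ptime f" "ptime g"
  shows "ptime (\<lambda>x. (f x, g x))"
proof -
  obtain p T where f: "pbounded T" "computes p T f"
    using assms(1) by (blast elim: ptimeE)
  obtain p' T' where g: "pbounded T'" "computes p' T' g"
    using assms(2) by (blast elim: ptimeE)
  obtain k where k: "\<forall>y \<in> com_vars p. y < k" "\<forall>y \<in> com_vars p'. y < k" "0 < k"
  proof -
    obtain k where "\<forall>y \<in> com_vars p \<union> com_vars p' \<union> {0}. y < k"
      using finite_nat_set_iff_bounded[of "com_vars p \<union> com_vars p' \<union> {0}"] by auto
    then show ?thesis using that[of k] by auto
  qed
  \<comment> \<open>Variable \<open>k\<close> keeps the input while \<open>p\<close> runs, and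
    \<open>Suc k\<close> keeps the result of \<open>p\<close> while \<open>p'\<close> runs; both are
    emptied in the end. The six assignments cost 14 steps, which the summand 20 below
    covers.\<close>
  define prog where "prog = Seq (Assign k (EVar 0)) (Seq p (Seq (Assign (Suc k) (EVar 0))
    (Seq (Assign 0 (EVar k)) (Seq (Assign k ENil) (Seq p' (Seq (Assign 0 (ECons (EVar (Suc k)) (EVar 0)))
    (Assign (Suc k) ENil)))))))"
  show ?thesis
  proof (rule ptimeI[of _ "\<lambda>x. T x + T' x + 20" prog])
    have "pbounded (\<lambda>x. 1 + sz (f x) + sz (g x))"
      by (intro pbounded_add pbounded_const ptime_pbounded assms)
    then show "pbounded (\<lambda>x. sz (f x, g x))"
      by simp
    show "pbounded (\<lambda>x. T x + T' x + 20)"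
      by (intro pbounded_add f g pbounded_const)
    fix x
    obtain t where t: "t \<le> T x" "exec p (init_state (repr x)) t (init_state (repr (f x)))"
      by (rule computesE[OF f(2)])
    obtain t' where t': "t' \<le> T' x" "exec p' (init_state (repr x)) t' (init_state (repr (g x)))"
      by (rule computesE[OF g(2)])
    let ?v = "repr x" and ?f = "repr (f x)" and ?g = "repr (g x)"
    let ?z = "\<lambda>_. Nl"
    have 1: "exec (Assign k (EVar 0)) (init_state ?v) 2 (?z(k := ?v, 0 := ?v))"
      using k(3) by (intro exec_AssignI) (auto simp: init_state_def)
    have 2: "exec p (?z(k := ?v, 0 := ?v)) t (?z(k := ?v, 0 := ?f))"
      using exec_frame[OF t(2) k(1,3), of "?z(k := ?v)"] k(3) by simp
    have 3: "exec (Assign (Suc k) (EVar 0)) (?z(k := ?v, 0 := ?f)) 2 (?z(k := ?v, Suc k := ?f, 0 := ?f))"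
      by (intro exec_AssignI) auto
    have 4: "exec (Assign 0 (EVar k)) (?z(k := ?v, Suc k := ?f, 0 := ?f)) 2 (?z(k := ?v, Suc k := ?f, 0 := ?v))"
      using k(3) by (intro exec_AssignI) auto
    have 5: "exec (Assign k ENil) (?z(k := ?v, Suc k := ?f, 0 := ?v)) 2 (?z(Suc k := ?f, 0 := ?v))"
      using k(3) by (intro exec_AssignI) auto
    have 6: "exec p' (?z(Suc k := ?f, 0 := ?v)) t' (?z(Suc k := ?f, 0 := ?g))"
      using exec_frame[OF t'(2) k(2,3), of "?z(Suc k := ?f)"] by simp
    have 7: "exec (Assign 0 (ECons (EVar (Suc k)) (EVar 0))) (?z(Suc k := ?f, 0 := ?g)) 4
      (?z(Suc k := ?f, 0 := Pr ?f ?g))"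
      by (intro exec_AssignI) auto
    have 8: "exec (Assign (Suc k) ENil) (?z(Suc k := ?f, 0 := Pr ?f ?g)) 2 (init_state (Pr ?f ?g))"
      by (intro exec_AssignI) (auto simp: init_state_def)
    have "exec prog (init_state ?v) (2 + (t + (2 + (2 + (2 + (t' + (4 + 2))))))) (init_state (Pr ?f ?g))"
      unfolding prog_def by (intro exec.Seq[OF 1] exec.Seq[OF 2] exec.Seq[OF 3] exec.Seq[OF 4] exec.Seq[OF 5]
        exec.Seq[OF 6] exec.Seq[OF 7] 8)
    then show "\<exists>t\<le>T x + T' x + 20. exec prog (init_state (repr x)) t (init_state (repr (f x, g x)))"
      using t t' by (intro exI[of _ "2 + (t + (2 + (2 + (2 + (t' + (4 + 2))))))"]) auto
  qed
qed

text \<open>Destructing a nonempty representation does not change it, so \<open>d\<close> costs nothing; its value on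
  the empty representation is irrelevant.\<close>

lemma ptime_branch:
  fixes b :: "'a :: repr \<Rightarrow> 'b :: repr" and d :: "'b \<Rightarrow> 'd :: repr"
  assumes "ptime b" "ptime f" "ptime g"
    and d: "\<And>y. repr y \<noteq> Nl \<Longrightarrow> repr (d y) = repr y"
  shows "ptime (\<lambda>x. if repr (b x) \<noteq> Nl then f (d (b x), x) else g x)"
proof -
  \<comment> \<open>Here the value of \<open>b\<close> is already part of the input, so the program
    tests just \<open>EHd (EVar 0)\<close>. Composition with \<open>(b x, x)\<close> gives the
    claim.\<close>
  define k where "k x = (if repr (fst x) \<noteq> Nl then f (d (fst x), snd x) else g (snd x))" for x
  obtain p T where f: "pbounded T" "computes p T f"
    using assms(2) by (blast elim: ptimeE)
  obtain p' T' where g: "pbounded T'" "computes p' T' g"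
    using assms(3) by (blast elim: ptimeE)
  have bound: "pbounded (\<lambda>x. if repr (fst x) \<noteq> Nl then h (d (fst x), snd x) else h' (snd x))"
    if h: "pbounded h" "pbounded h'" for h :: "'d \<times> 'a \<Rightarrow> nat" and h' :: "'a \<Rightarrow> nat"
  proof -
    obtain c e where *: "\<And>x. h x \<le> c * (sz x + 1) ^ e"
      using h unfolding pbounded_def by blast
    obtain c' e' where **: "\<And>x. h' x \<le> c' * (sz x + 1) ^ e'"
      using h unfolding pbounded_def by blast
    let ?B = "\<lambda>x. c * (sz x + 1) ^ e + c' * (sz x + 1) ^ e'"
    have "pbounded ?B"
      by (intro pbounded_add pbounded_mult pbounded_power pbounded_const pbounded_sz)
    then show ?thesis
    proof (rule pbounded_mono)
      fix x :: "'b \<times> 'a"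
      have "sz (d (fst x), snd x) = sz x" if "repr (fst x) \<noteq> Nl"
        using d[OF that] by (simp add: sz_pair) (simp add: sz_def)
      then have "h (d (fst x), snd x) \<le> c * (sz x + 1) ^ e" if "repr (fst x) \<noteq> Nl"
        using *[of "(d (fst x), snd x)"] that by simp
      moreover have "h' (snd x) \<le> c' * (sz x + 1) ^ e'"
        by (rule order_trans[OF **]) (simp add: sz_pair power_mono)
      ultimately show "(if repr (fst x) \<noteq> Nl then h (d (fst x), snd x) else h' (snd x)) \<le> ?B x"
        by (auto intro: trans_le_add1 trans_le_add2)
    qed
  qed
  define prog where "prog = If (EHd (EVar 0)) p (Seq (Assign 0 (ETl (EVar 0))) p')"
  define t0 where "t0 x = (if repr (fst x) \<noteq> Nl then T (d (fst x), snd x) else T' (snd x))" for x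
  have "ptime k"
  proof (rule ptimeI[of _ "\<lambda>x. t0 x + 10" prog])
    show "pbounded (\<lambda>x. sz (k x))"
      using bound[OF ptime_pbounded ptime_pbounded, OF assms(2,3)]
      by (rule pbounded_mono) (simp add: k_def)
    show "pbounded (\<lambda>x. t0 x + 10)"
      unfolding t0_def by (intro pbounded_add bound f g pbounded_const)
    fix x :: "'b \<times> 'a"
    show "\<exists>t\<le>t0 x + 10. exec prog (init_state (repr x)) t (init_state (repr (k x)))"
    proof (cases "repr (fst x) = Nl")
      case True
      have 1: "exec (Assign 0 (ETl (EVar 0))) (init_state (repr x)) 3 (init_state (repr (snd x)))"
        by (intro exec_AssignI) (auto simp: repr_pair)
      obtain t where t: "t \<le> T' (snd x)" "exec p' (init_state (repr (snd x))) t (init_state (repr (g (snd x))))"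
        by (rule computesE[OF g(2)])
      show ?thesis
        using exec.IfFalse[OF _ exec.Seq[OF 1 t(2)], of "EHd (EVar 0)" p] True t(1)
        unfolding prog_def by (intro exI[of _ "6 + t"]) (simp add: k_def t0_def repr_pair)
    next
      case False
      let ?x = "(d (fst x), snd x)"
      have x: "repr ?x = repr x"
        using d[OF False] by (simp add: repr_pair)
      obtain t where t: "t \<le> T ?x" "exec p (init_state (repr ?x)) t (init_state (repr (f ?x)))"
        by (rule computesE[OF f(2)])
      show ?thesis
        using exec.IfTrue[OF _ t(2), of "EHd (EVar 0)"] False t(1) d[OF False]
        unfolding prog_def by (intro exI[of _ "Suc (Suc (Suc t))"]) (simp add: k_def t0_def repr_pair)
    qed
  qed
  from ptime_comp[OF this ptime_Pair[OF assms(1) ptime_ident]] show ?thesis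
    by (simp add: k_def cong: if_cong)
qed

lemma ptime_If:
  assumes "ptime b" "ptime f" "ptime g"
  shows "ptime (\<lambda>x. if b x then f x else g x)"
proof -
  have "(repr b \<noteq> Nl) = b" for b :: bool
    by (cases b) auto
  with ptime_branch[OF assms(1) ptime_comp[OF assms(2) ptime_snd_basic] assms(3), of "\<lambda>b. b"]
  show ?thesis by (simp cong: if_cong)
qed

text \<open>A nonempty list and the pair of its head and tail have the same encoding, so
  \<open>ptime_branch\<close> applies with \<open>d y = (hd y, tl y)\<close>.\<close>

lemma ptime_case_list:
  fixes l :: "'a :: repr \<Rightarrow> 'b :: repr list"
  assumes "ptime l" "ptime f" "ptime (\<lambda>e. g (fst e) (fst (snd e)) (snd (snd e)))"
  shows "ptime (\<lambda>x. case l x of [] \<Rightarrow> f x | y # ys \<Rightarrow> g x y ys)"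
proof -
  have 1: "ptime (\<lambda>e :: ('b \<times> 'b list) \<times> 'a. g (snd e) (fst (fst e)) (snd (fst e)))"
    using ptime_comp[OF assms(3), of "\<lambda>e. (snd e, fst e)"]
    by (simp add: ptime_Pair ptime_fst_basic ptime_snd_basic)
  have "repr (hd y, tl y) = repr y" if "repr y \<noteq> Nl" for y :: "'b list"
    using that by (cases y) auto
  from ptime_branch[OF assms(1) 1 assms(2) this]
  have "ptime (\<lambda>x. if repr (l x) \<noteq> Nl then g x (hd (l x)) (tl (l x)) else f x)"
    by (simp cong: if_cong)
  moreover have "(if repr (l x) \<noteq> Nl then g x (hd (l x)) (tl (l x)) else f x)
      = (case l x of [] \<Rightarrow> f x | y # ys \<Rightarrow> g x y ys)" for x
    by (cases "l x") auto
  ultimately show ?thesis by simp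
qed

subsection \<open>Loops\<close>

text \<open>The number of iterations is a parameter here, since the loop over all colorings of a hub runs
  exponentially often.\<close>

definition iterates :: "com \<Rightarrow> nat \<Rightarrow> nat \<Rightarrow> ('g :: repr \<times> 'a :: repr \<Rightarrow> 'g \<times> 'a) \<Rightarrow> bool" where
  "iterates p c d f \<longleftrightarrow> (\<forall>x N b. (\<forall>i < N. repr (fst ((f ^^ i) x)) \<noteq> Nl \<and> sz ((f ^^ i) x) \<le> b) \<longrightarrow>
    repr (fst ((f ^^ N) x)) = Nl \<longrightarrow>
    (\<exists>t \<le> (N + 1) * (c * (b + 1) ^ d). exec p (init_state (repr x)) t (init_state (repr ((f ^^ N) x)))))"

lemma iteratesE:
  assumes "iterates p c d f"
    and "\<And>i. i < N \<Longrightarrow> repr (fst ((f ^^ i) x)) \<noteq> Nl" "\<And>i. i < N \<Longrightarrow> sz ((f ^^ i) x) \<le> b"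
    and "repr (fst ((f ^^ N) x)) = Nl"
  obtains t where "t \<le> (N + 1) * (c * (b + 1) ^ d)"
    "exec p (init_state (repr x)) t (init_state (repr ((f ^^ N) x)))"
  using assms unfolding iterates_def by blast

text \<open>The guard is the first component of the state, so a single \<open>While\<close> on
  \<open>EHd (EVar 0)\<close> suffices. \<open>iterates\<close> presupposes a bound on all
  intermediate sizes because iterating a polynomial-time function can let them explode.\<close>

lemma ptime_iterates:
  fixes f :: "'g :: repr \<times> 'a :: repr \<Rightarrow> 'g \<times> 'a"
  assumes "ptime f"
  shows "\<exists>p c d. iterates p c d f"
proof -
  obtain p T where f: "pbounded T" "computes p T f"
    using assms by (blast elim: ptimeE)
  obtain c d where T: "\<And>x. T x \<le> c * (sz x + 1) ^ d"
    using f(1) unfolding pbounded_def by blast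
  let ?w = "While (EHd (EVar 0)) p"
  \<comment> \<open>The 3 pays for one test, \<open>1 + exp_cost (EHd (EVar 0))\<close>; there are
    \<open>N\<close> successful tests and a failing one.\<close>
  have "\<exists>t \<le> (N + 1) * ((c + 3) * (b + 1) ^ d). exec ?w (init_state (repr x)) t (init_state (repr ((f ^^ N) x)))"
    if "\<And>i. i < N \<Longrightarrow> repr (fst ((f ^^ i) x)) \<noteq> Nl" "repr (fst ((f ^^ N) x)) = Nl"
      "\<And>i. i < N \<Longrightarrow> sz ((f ^^ i) x) \<le> b" for x N b
    using that
  proof (induction N arbitrary: x)
    case 0
    then have "exec ?w (init_state (repr x)) 3 (init_state (repr x))"
      using exec.WhileFalse[of "EHd (EVar 0)" "init_state (repr x)" p] by (simp add: repr_pair eval_nat_numeral)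
    moreover have "3 \<le> (c + 3) * (b + 1) ^ d"
      using mult_le_mono[of 3 "c + 3" 1 "(b + 1) ^ d"] by simp
    ultimately show ?case by auto
  next
    case (Suc N)
    have shift: "(f ^^ i) (f x) = (f ^^ Suc i) x" for i
      by (simp add: funpow_swap1)
    have "\<exists>t \<le> (N + 1) * ((c + 3) * (b + 1) ^ d).
      exec ?w (init_state (repr (f x))) t (init_state (repr ((f ^^ N) (f x))))"
    proof (rule Suc.IH)
      show "repr (fst ((f ^^ i) (f x))) \<noteq> Nl" if "i < N" for i
        using Suc.prems(1)[of "Suc i"] that unfolding shift by simp
      show "sz ((f ^^ i) (f x)) \<le> b" if "i < N" for i
        using Suc.prems(3)[of "Suc i"] that unfolding shift by simp
    qed (use Suc.prems(2) shift in simp)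
    then obtain t where t: "t \<le> (N + 1) * ((c + 3) * (b + 1) ^ d)"
      "exec ?w (init_state (repr (f x))) t (init_state (repr ((f ^^ Suc N) x)))"
      unfolding shift by blast
    obtain t' where t': "t' \<le> T x" "exec p (init_state (repr x)) t' (init_state (repr (f x)))"
      by (rule computesE[OF f(2)])
    have "T x \<le> c * (b + 1) ^ d"
    proof (rule order_trans[OF T])
      show "c * (sz x + 1) ^ d \<le> c * (b + 1) ^ d"
        using Suc.prems(3)[of 0] by (intro mult_le_mono power_mono) auto
    qed
    moreover have "3 * 1 \<le> 3 * (b + 1) ^ d"
      by (intro mult_le_mono) auto
    ultimately have "3 + t' \<le> (c + 3) * (b + 1) ^ d"
      using t'(1) unfolding distrib_right by linarith
    then have "3 + t' + t \<le> (Suc N + 1) * ((c + 3) * (b + 1) ^ d)"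
      using t(1) by simp
    moreover have "exec ?w (init_state (repr x)) (3 + t' + t) (init_state (repr ((f ^^ Suc N) x)))"
      using exec.WhileTrue[OF _ t'(2) t(2)] Suc.prems(1)[of 0]
      by (simp add: repr_pair numeral_3_eq_3)
    ultimately show ?case by blast
  qed
  then have "iterates ?w (c + 3) d f"
    unfolding iterates_def by blast
  then show ?thesis by blast
qed

lemma ptime_Cons:
  fixes f :: "'a :: repr \<Rightarrow> 'b :: repr"
  assumes "ptime f" "ptime g"
  shows "ptime (\<lambda>x. f x # g x)"
  by (rule ptime_same_repr[OF ptime_Pair[OF assms]]) simp

lemma ptime_Suc: "ptime f \<Longrightarrow> ptime (\<lambda>x. Suc (f x))"
  by (rule ptime_same_repr[OF ptime_Pair[OF ptime_const[of Nl]], of f]) simp_all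

text \<open>The unread part of the list is the loop guard, and \<open>x\<close> travels along
  unchanged so that \<open>step\<close> may depend on it.\<close>

lemma ptime_fold_bounded:
  fixes l :: "'a :: repr \<Rightarrow> 'b :: repr list" and init :: "'a \<Rightarrow> 's :: repr"
  assumes "ptime l" "ptime init" "ptime (\<lambda>e. step (fst e) (fst (snd e)) (snd (snd e)))"
    and B: "pbounded B" "\<And>x i. i \<le> length (l x) \<Longrightarrow> sz (fold (step x) (take i (l x)) (init x)) \<le> B x"
  shows "ptime (\<lambda>x. fold (step x) (l x) (init x))"
proof -
  define body where "body e = (case fst e of [] \<Rightarrow> e
    | y # ys \<Rightarrow> (ys, fst (snd e), step (fst (snd e)) y (snd (snd e))))" for e :: "'b list \<times> 'a \<times> 's"
  have "ptime body"
    unfolding body_def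
    using ptime_comp[OF assms(3), of "\<lambda>e. (fst (snd (fst e)), fst (snd e), snd (snd (fst e)))"]
    by (intro ptime_case_list ptime_Pair ptime_fst ptime_snd ptime_ident) (simp add: ptime_Pair ptime_fst ptime_snd ptime_ident)
  then obtain p c d where loop: "iterates p c d body"
    using ptime_iterates by blast
  have start: "ptime (\<lambda>x. (l x, x, init x))"
    by (intro ptime_Pair assms ptime_ident)
  then obtain p' T' where start': "pbounded T'" "computes p' T' (\<lambda>x. (l x, x, init x))"
    by (blast elim: ptimeE)
  have iter: "(body ^^ i) (l x, x, init x) = (drop i (l x), x, fold (step x) (take i (l x)) (init x))"
    if "i \<le> length (l x)" for i x
    using that
  proof (induction i)
    case (Suc i)
    then have d: "drop i (l x) = l x ! i # drop (Suc i) (l x)"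
      by (intro Cons_nth_drop_Suc[symmetric]) auto
    with Suc show ?case
      by (simp add: body_def take_Suc_conv_app_nth)
  qed simp
  \<comment> \<open>The 2 counts the \<open>Pr\<close> nodes that join the three parts of the loop
    state.\<close>
  define b where "b x = 2 + sz (l x) + sz x + B x" for x
  define T where "T x = T' x + (length (l x) + 1) * (c * (b x + 1) ^ d)" for x
  have T: "pbounded T"
  proof -
    have "pbounded (\<lambda>x. length (l x))"
      using ptime_pbounded[OF assms(1)] by (rule pbounded_mono) (rule length_le_sz)
    then show ?thesis
      unfolding T_def b_def
      by (intro pbounded_add pbounded_mult pbounded_power pbounded_const pbounded_sz start' B ptime_pbounded assms)
  qed
  have run: "\<exists>t \<le> T x. exec (Seq p' p) (init_state (repr x)) t
      (init_state (repr (([], x, fold (step x) (l x) (init x)) :: 'b list \<times> 'a \<times> 's)))" for x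
  proof -
    let ?s = "(l x, x, init x)" and ?N = "length (l x)"
    obtain t' where t': "t' \<le> T' x" "exec p' (init_state (repr x)) t' (init_state (repr ?s))"
      by (rule computesE[OF start'(2)])
    obtain t where "t \<le> (?N + 1) * (c * (b x + 1) ^ d)" "exec p (init_state (repr ?s)) t (init_state (repr ((body ^^ ?N) ?s)))"
    proof (rule iteratesE[OF loop, of ?N ?s "b x"])
      show "repr (fst ((body ^^ i) ?s)) \<noteq> Nl" if "i < ?N" for i
        using that Cons_nth_drop_Suc[OF that, symmetric] by (simp add: iter)
      show "sz ((body ^^ i) ?s) \<le> b x" if "i < ?N" for i
        using that B(2)[of i x] sz_drop_le[of i "l x"] by (simp add: iter b_def)
    qed (simp add: iter)
    then show ?thesis
      using exec.Seq[OF t'(2)] t'(1) unfolding T_def by (intro exI[of _ "t' + t"]) (simp add: iter)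
  qed
  have "ptime (\<lambda>x. (([], x, fold (step x) (l x) (init x)) :: 'b list \<times> 'a \<times> 's))"
  proof (rule ptimeI[OF _ T run])
    have "pbounded (\<lambda>x. 2 + sz x + B x)"
      by (intro pbounded_add pbounded_const pbounded_sz B)
    then show "pbounded (\<lambda>x. sz (([], x, fold (step x) (l x) (init x)) :: 'b list \<times> 'a \<times> 's))"
    proof (rule pbounded_mono)
      show "sz (([], x, fold (step x) (l x) (init x)) :: 'b list \<times> 'a \<times> 's) \<le> 2 + sz x + B x" for x
        using B(2)[of "length (l x)" x] by simp
    qed
  qed
  from ptime_snd[OF ptime_snd[OF this]] show ?thesis by simp
qed

text \<open>The growth per step is additive and does not depend on the accumulator, so it sums up to
  a polynomial over the whole list.\<close>

lemma ptime_fold: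
  fixes l :: "'a :: repr \<Rightarrow> 'b :: repr list" and init :: "'a \<Rightarrow> 's :: repr"
  assumes "ptime l" "ptime init" "ptime (\<lambda>e. step (fst e) (fst (snd e)) (snd (snd e)))"
    and h: "pbounded h" "\<And>x y s. sz (step x y s) \<le> sz s + h (x, y)"
  shows "ptime (\<lambda>x. fold (step x) (l x) (init x))"
proof -
  obtain c d where c: "\<And>e. h e \<le> c * (sz e + 1) ^ d"
    using h(1) unfolding pbounded_def by blast
  \<comment> \<open>Bounds \<open>h (x, y)\<close> for all members \<open>y\<close> of
    \<open>l x\<close> at once, since \<open>sz y < sz (l x)\<close> and
    \<open>sz (x, y) + 1 = sz x + sz y + 2\<close>.\<close>
  define k where "k x = c * (sz x + sz (l x) + 2) ^ d" for x
  show ?thesis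
  proof (rule ptime_fold_bounded[OF assms(1-3)])
    show "pbounded (\<lambda>x. sz (init x) + sz (l x) * k x)"
      unfolding k_def
      by (intro pbounded_add pbounded_mult pbounded_power pbounded_const pbounded_sz ptime_pbounded assms)
    fix x i assume "i \<le> length (l x)"
    have "sz (fold (step x) ys s) \<le> sz s + length ys * k x" if "set ys \<subseteq> set (l x)" for ys s
      using that
    proof (induction ys arbitrary: s)
      case (Cons y ys)
      have "h (x, y) \<le> k x"
        unfolding k_def using Cons.prems sz_member[of y "l x"]
        by (intro order_trans[OF c] mult_le_mono power_mono) auto
      then have "sz (step x y s) \<le> sz s + k x"
        using h(2)[of x y s] by simp
      then show ?case
        using Cons.IH[of "step x y s"] Cons.prems by simp
    qed simp
    from this[OF set_take_subset, of i "init x"]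
    have "sz (fold (step x) (take i (l x)) (init x)) \<le> sz (init x) + length (take i (l x)) * k x" .
    also have "\<dots> \<le> sz (init x) + sz (l x) * k x"
      using length_le_sz[of "l x"] by (intro add_mono mult_le_mono) auto
    finally show "sz (fold (step x) (take i (l x)) (init x)) \<le> sz (init x) + sz (l x) * k x" .
  qed
qed


subsection \<open>Booleans, numbers and lists\<close>

named_theorems ptime_intros

declare ptime_ident [ptime_intros] ptime_const [ptime_intros] ptime_fst [ptime_intros]
  ptime_snd [ptime_intros] ptime_Pair [ptime_intros] ptime_If [ptime_intros]
  ptime_case_list [ptime_intros] ptime_Cons [ptime_intros] ptime_Suc [ptime_intros]

lemma ptime_Not [ptime_intros]:
  assumes "ptime P"
  shows "ptime (\<lambda>x. \<not> P x)"
proof -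
  have "(\<not> p) = (if p then False else True)" for p
    by simp
  then show ?thesis
    by (simp only:) (intro ptime_If ptime_const assms)
qed

lemma ptime_conj [ptime_intros]: "ptime P \<Longrightarrow> ptime Q \<Longrightarrow> ptime (\<lambda>x. P x \<and> Q x)"
  using ptime_If[of P Q "\<lambda>_. False"] by (simp add: ptime_const if_bool_eq_conj conj_commute cong: conj_cong)

lemma ptime_disj [ptime_intros]: "ptime P \<Longrightarrow> ptime Q \<Longrightarrow> ptime (\<lambda>x. P x \<or> Q x)"
  using ptime_Not[OF ptime_conj[OF ptime_Not ptime_Not], of P Q] by simp

lemma ptime_imp [ptime_intros]: "ptime P \<Longrightarrow> ptime Q \<Longrightarrow> ptime (\<lambda>x. P x \<longrightarrow> Q x)"
  using ptime_disj[OF ptime_Not, of P Q] unfolding imp_conv_disj .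

lemma ptime_rev [ptime_intros]:
  fixes l :: "'a :: repr \<Rightarrow> 'b :: repr list"
  assumes "ptime l"
  shows "ptime (\<lambda>x. rev (l x))"
proof -
  have "ptime (\<lambda>x. fold Cons (l x) [])"
    using pbounded_add[OF pbounded_const[of 1] pbounded_sz]
    by (rule ptime_fold[rotated 3]) (simp, (intro ptime_intros assms)+)
  moreover have "fold Cons xs [] = rev xs" for xs :: "'b list"
    by (simp add: rev_conv_fold)
  ultimately show ?thesis by simp
qed

lemma ptime_append [ptime_intros]:
  fixes l :: "'a :: repr \<Rightarrow> 'b :: repr list"
  assumes "ptime l" "ptime l'"
  shows "ptime (\<lambda>x. l x @ l' x)"
proof -
  have "ptime (\<lambda>x. fold Cons (rev (l x)) (l' x))"
    using pbounded_add[OF pbounded_const[of 1] pbounded_sz]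
    by (rule ptime_fold[rotated 3]) (simp, (intro ptime_intros assms)+)
  moreover have "fold Cons (rev xs) ys = xs @ ys" for xs ys :: "'b list"
    by (induction xs) auto
  ultimately show ?thesis by simp
qed

lemma ptime_concat [ptime_intros]:
  fixes l :: "'a :: repr \<Rightarrow> 'b :: repr list list"
  assumes "ptime l"
  shows "ptime (\<lambda>x. concat (l x))"
proof -
  have "ptime (\<lambda>x. fold (\<lambda>ys zs. zs @ ys) (l x) [])"
    using pbounded_sz by (rule ptime_fold[rotated 3]) (simp, (intro ptime_intros assms)+)
  moreover have "fold (\<lambda>ys zs. zs @ ys) yss zs = zs @ concat yss" for yss and zs :: "'b list"
    by (induction yss arbitrary: zs) auto
  ultimately show ?thesis by simp
qed

lemma ptime_map [ptime_intros]:
  fixes l :: "'a :: repr \<Rightarrow> 'b :: repr list" and f :: "'a \<Rightarrow> 'b \<Rightarrow> 'c :: repr"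
  assumes "ptime l" "ptime (\<lambda>e. f (fst e) (snd e))"
  shows "ptime (\<lambda>x. map (f x) (l x))"
proof -
  have f: "ptime (\<lambda>e. f (fst e) (fst (snd e)))"
    using ptime_comp[OF assms(2), of "\<lambda>e. (fst e, fst (snd e))"] by (simp add: ptime_intros)
  have "ptime (\<lambda>x. fold (\<lambda>y ys. f x y # ys) (l x) [])"
  proof (rule ptime_fold[OF assms(1)])
    show "pbounded (\<lambda>e. 1 + sz (f (fst e) (snd e)))"
      by (intro pbounded_add pbounded_const ptime_pbounded assms)
  qed (auto intro!: ptime_intros f)
  then have "ptime (\<lambda>x. rev (fold (\<lambda>y ys. f x y # ys) (l x) []))"
    by (rule ptime_rev)
  moreover have "fold (\<lambda>y ys. g y # ys) xs ys = rev (map g xs) @ ys" for g :: "'b \<Rightarrow> 'c" and xs ys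
    by (induction xs arbitrary: ys) auto
  ultimately show ?thesis by simp
qed

lemma ptime_filter [ptime_intros]:
  fixes l :: "'a :: repr \<Rightarrow> 'b :: repr list"
  assumes "ptime l" "ptime (\<lambda>e. P (fst e) (snd e))"
  shows "ptime (\<lambda>x. filter (P x) (l x))"
proof -
  have "ptime (\<lambda>x. concat (map (\<lambda>y. if P x y then [y] else []) (l x)))"
    by (intro ptime_intros assms)
  moreover have "concat (map (\<lambda>y. if p y then [y] else []) xs) = filter p xs" for p and xs :: "'b list"
    by (induction xs) auto
  ultimately show ?thesis by simp
qed

lemma ptime_Ball [ptime_intros]:
  fixes l :: "'a :: repr \<Rightarrow> 'b :: repr list"
  assumes "ptime l" "ptime (\<lambda>e. P (fst e) (snd e))"
  shows "ptime (\<lambda>x. \<forall>y \<in> set (l x). P x y)"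
proof -
  have "ptime (\<lambda>x. case filter (\<lambda>y. \<not> P x y) (l x) of [] \<Rightarrow> True | y # ys \<Rightarrow> False)"
    by (intro ptime_intros assms)
  moreover have "(case filter (\<lambda>y. \<not> p y) xs of [] \<Rightarrow> True | y # ys \<Rightarrow> False) = (\<forall>y \<in> set xs. p y)"
    for p and xs :: "'b list"
    by (induction xs) auto
  ultimately show ?thesis by simp
qed

lemma ptime_Bex [ptime_intros]:
  fixes l :: "'a :: repr \<Rightarrow> 'b :: repr list"
  assumes "ptime l" "ptime (\<lambda>e. P (fst e) (snd e))"
  shows "ptime (\<lambda>x. \<exists>y \<in> set (l x). P x y)"
  using ptime_Not[OF ptime_Ball[OF assms(1) ptime_Not[OF assms(2)]]] by simp

lemma ptime_length [ptime_intros]: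
  fixes l :: "'a :: repr \<Rightarrow> 'b :: repr list"
  assumes "ptime l"
  shows "ptime (\<lambda>x. length (l x))"
proof -
  have "ptime (\<lambda>x. fold (\<lambda>_ n. Suc n) (l x) 0)"
    using pbounded_const[of 1] by (rule ptime_fold[rotated 3]) (simp, (intro ptime_intros assms)+)
  moreover have "fold (\<lambda>_ n. Suc n) xs n = n + length xs" for xs :: "'b list" and n
    by (induction xs arbitrary: n) auto
  ultimately show ?thesis by simp
qed

text \<open>Through this identity, iteration over a number becomes a fold over
  \<open>replicate n Nl\<close>.\<close>

lemma repr_nat_eq_list: "repr n = repr (replicate n Nl)"
  by (induction n) auto

lemma ptime_replicate_Nl [ptime_intros]: "ptime f \<Longrightarrow> ptime (\<lambda>x. replicate (f x) Nl)"
  by (rule ptime_same_repr[of f]) (simp_all add: repr_nat_eq_list)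

lemma ptime_drop [ptime_intros]:
  fixes l :: "'a :: repr \<Rightarrow> 'b :: repr list"
  assumes "ptime f" "ptime l"
  shows "ptime (\<lambda>x. drop (f x) (l x))"
proof -
  have tl: "tl ys = (case ys of [] \<Rightarrow> [] | z # zs \<Rightarrow> zs)" for ys :: "'b list"
    by (cases ys) auto
  have "ptime (\<lambda>x. fold (\<lambda>_. tl) (replicate (f x) Nl) (l x))"
  proof (rule ptime_fold[OF _ _ _ pbounded_const[of 0]])
    show "sz (tl ys) \<le> sz ys + 0" for ys :: "'b list"
      by (cases ys) auto
    show "ptime (\<lambda>e :: 'a \<times> val \<times> 'b list. tl (snd (snd e)))"
      unfolding tl by (intro ptime_intros)
  qed (intro ptime_intros assms)+
  moreover have "(tl ^^ n) ys = drop n ys" for n and ys :: "'b list"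
    by (induction n) (auto simp: drop_Suc drop_tl)
  ultimately show ?thesis by simp
qed

text \<open>Totality makes lookup a \<open>ptime\<close> function without side conditions on the
  index.\<close>

definition nth_default :: "'a \<Rightarrow> 'a list \<Rightarrow> nat \<Rightarrow> 'a" where
  "nth_default d xs i = (case drop i xs of [] \<Rightarrow> d | x # _ \<Rightarrow> x)"

lemma nth_default_nth: "i < length xs \<Longrightarrow> nth_default d xs i = xs ! i"
  by (simp add: nth_default_def Cons_nth_drop_Suc[symmetric])

lemma ptime_nth_default [ptime_intros]:
  assumes "ptime l" "ptime f"
  shows "ptime (\<lambda>x. nth_default d (l x) (f x))"
  unfolding nth_default_def by (intro ptime_intros assms)

text \<open>Two numbers are equal iff both truncated differences vanish, and a truncated difference
  is \<open>drop\<close> on unary numbers.\<close>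

lemma ptime_nat_eq [ptime_intros]:
  assumes "ptime f" "ptime g"
  shows "ptime (\<lambda>x. f x = (g x :: nat))"
proof -
  have "ptime (\<lambda>x. drop (f x) (replicate (g x) Nl))" "ptime (\<lambda>x. drop (g x) (replicate (f x) Nl))"
    by (intro ptime_intros assms)+
  then have d: "ptime (\<lambda>x. replicate (g x - f x) Nl)" "ptime (\<lambda>x. replicate (f x - g x) Nl)"
    by simp_all
  have "ptime (\<lambda>x. (case replicate (g x - f x) Nl of [] \<Rightarrow> True | _ # _ \<Rightarrow> False) \<and>
    (case replicate (f x - g x) Nl of [] \<Rightarrow> True | _ # _ \<Rightarrow> False))"
    by (intro ptime_intros d)
  moreover have "(case replicate n Nl of [] \<Rightarrow> True | _ # _ \<Rightarrow> False) = (n = 0)" for n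
    by (cases n) auto
  moreover have "(m - n = 0 \<and> n - m = 0) = (n = m)" for m n :: nat
    by auto
  ultimately show ?thesis by (simp only:)
qed

lemma ptime_pair_eq [ptime_intros]:
  assumes "ptime (\<lambda>x. fst (f x) = fst (g x))" "ptime (\<lambda>x. snd (f x) = snd (g x))"
  shows "ptime (\<lambda>x. f x = g x)"
  using ptime_conj[OF assms] by (simp add: prod_eq_iff)

lemma ptime_eq_Nil [ptime_intros]:
  assumes "ptime l"
  shows "ptime (\<lambda>x. l x = [])"
proof -
  have "(ys = []) = (case ys of [] \<Rightarrow> True | _ # _ \<Rightarrow> False)" for ys :: "'b list"
    by (cases ys) auto
  then show ?thesis
    by (simp only:) (intro ptime_intros assms)
qed

lemma ptime_list_eq:
  fixes f g :: "'a :: repr \<Rightarrow> 'b :: repr list"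
  assumes eq: "ptime (\<lambda>e :: 'b \<times> 'b. fst e = snd e)" and "ptime f" "ptime g"
  shows "ptime (\<lambda>x. f x = g x)"
proof -
  \<comment> \<open>The state holds whether the lists have agreed so far and the unread rest of the
    second list. If the rest runs out early, the flag becomes \<open>False\<close>; a rest left over
    in the end is tested separately.\<close>
  define step where "step y s = (case snd s of [] \<Rightarrow> (False, []) | z # zs \<Rightarrow> (fst s \<and> y = z, zs))"
    for y :: 'b and s :: "bool \<times> 'b list"
  have eq': "ptime (\<lambda>x. u x = v x)" if "ptime u" "ptime v" for u v :: "'c :: repr \<Rightarrow> 'b"
    using ptime_comp[OF eq ptime_Pair[OF that]] by simp
  have fold: "ptime (\<lambda>x. fold step (f x) (True, g x))"
  proof (rule ptime_fold[OF _ _ _ pbounded_const[of 1]])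
    show "sz (step y s) \<le> sz s + 1" for y s
      by (cases s; cases "snd s") (auto simp: step_def intro!: order_trans[OF sz_bool_le])
    show "ptime (\<lambda>e. step (fst (snd e)) (snd (snd e)))"
      unfolding step_def by (intro ptime_intros eq')
  qed (intro ptime_intros assms)+
  have "fst (fold step xs (b, ys)) \<and> snd (fold step xs (b, ys)) = [] \<longleftrightarrow> b \<and> xs = ys" for xs b ys
  proof (induction xs arbitrary: b ys)
    case (Cons x xs)
    show ?case
    proof (cases ys)
      case Nil
      then show ?thesis
        using Cons.IH[of False "[]"] by (simp add: step_def)
    next
      case (Cons z zs)
      then show ?thesis
        using Cons.IH[of "b \<and> x = z" zs] by (auto simp: step_def)
    qed
  qed auto
  from this[of "f x" True "g x" for x]
  have "(\<lambda>x. f x = g x) = (\<lambda>x. fst (fold step (f x) (True, g x)) \<and> snd (fold step (f x) (True, g x)) = [])"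
    by (intro ext) simp
  moreover have "ptime (\<lambda>x. fst (fold step (f x) (True, g x)) \<and> snd (fold step (f x) (True, g x)) = [])"
    by (intro ptime_intros fold)
  ultimately show ?thesis by (simp only:)
qed

text \<open>Appending the current length grows by an amount that depends on the accumulator, so
  \<open>ptime_fold\<close> does not fit. The intermediate lists \<open>[0..<i]\<close> are known
  and of quadratic size.\<close>

lemma ptime_upt [ptime_intros]:
  assumes "ptime f"
  shows "ptime (\<lambda>x. [0..<f x])"
proof -
  let ?s = "\<lambda>ys. ys @ [length ys]"
  have iter: "(?s ^^ n) [] = [0..<n]" for n
    by (induction n) auto
  have "ptime (\<lambda>x. fold (\<lambda>_. ?s) (replicate (f x) Nl) [])"
  proof (rule ptime_fold_bounded)
    show "pbounded (\<lambda>x. sz (f x) * (1 + sz (f x)))"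
      by (intro pbounded_mult pbounded_add pbounded_const ptime_pbounded assms)
    fix x i assume "i \<le> length (replicate (f x) Nl)"
    then have i: "i \<le> f x" by simp
    have "sz [0..<i] \<le> length [0..<i] * Suc i"
      by (rule sz_list_le) auto
    also have "\<dots> \<le> f x * Suc (f x)"
      using i by (intro mult_le_mono) auto
    finally show "sz (fold (\<lambda>_. ?s) (take i (replicate (f x) Nl)) []) \<le> sz (f x) * (1 + sz (f x))"
      using i by (simp add: iter min_absorb1)
  qed (intro ptime_intros assms)+
  then show ?thesis by (simp add: iter)
qed

lemma ptime_zip [ptime_intros]:
  fixes f :: "'a :: repr \<Rightarrow> 'b :: repr list" and g :: "'a \<Rightarrow> 'c :: repr list"
  assumes "ptime f" "ptime g"
  shows "ptime (\<lambda>x. zip (f x) (g x))"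
proof -
  have "ptime (\<lambda>x. concat (map (\<lambda>i. case drop i (f x) of [] \<Rightarrow> [] | y # _ \<Rightarrow>
    (case drop i (g x) of [] \<Rightarrow> [] | z # _ \<Rightarrow> [(y, z)])) [0..<length (f x)]))"
    by (intro ptime_intros ptime_comp[OF assms(1)] ptime_comp[OF assms(2)])
  moreover have "concat (map (\<lambda>i. case drop i ys of [] \<Rightarrow> [] | y # _ \<Rightarrow>
    (case drop i zs of [] \<Rightarrow> [] | z # _ \<Rightarrow> [(y, z)])) [0..<length ys]) = zip ys zs"
    for ys :: "'b list" and zs :: "'c list"
  proof (induction ys arbitrary: zs)
    case (Cons y ys)
    have "[0..<length (y # ys)] = 0 # map Suc [0..<length ys]"
      by (simp add: upt_conv_Cons map_Suc_upt del: upt_Suc)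
    then show ?case
    proof (cases zs)
      case Nil
      then show ?thesis
        by (auto split: list.split)
    next
      case (Cons z zs')
      with \<open>[0..<length (y # ys)] = _\<close> show ?thesis
        using Cons.IH[of zs'] by (simp add: comp_def del: upt_Suc cong: list.case_cong)
    qed
  qed simp
  ultimately show ?thesis by simp
qed

text \<open>The exponent \<open>k\<close> is fixed and not part of the input. This is what makes
  trying all \<open>\<sigma>\<close>-tuples of vertices polynomial.\<close>

lemma ptime_n_lists [ptime_intros]:
  fixes f :: "'a :: repr \<Rightarrow> 'b :: repr list"
  assumes "ptime f"
  shows "ptime (\<lambda>x. List.n_lists k (f x))"
proof (induction k)
  case 0
  show ?case by (simp add: ptime_const)
next
  case (Suc k)
  then show ?case
    unfolding List.n_lists.simps by (intro ptime_intros ptime_comp[OF assms])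
qed


section \<open>The algorithm\<close>

subsection \<open>Exhaustive search with an odometer\<close>

text \<open>The \<open>p\<close> lowest base-\<open>q\<close> digits, least significant first;
  position \<open>i\<close> of the search is the candidate \<open>digits q p i\<close>.\<close>

fun digits :: "nat \<Rightarrow> nat \<Rightarrow> nat \<Rightarrow> nat list" where
  "digits q 0 i = []"
| "digits q (Suc p) i = i mod q # digits q p (i div q)"

lemma length_digits [simp]: "length (digits q p i) = p"
  by (induction p arbitrary: i) auto

lemma digits_less: "0 < q \<Longrightarrow> set (digits q p i) \<subseteq> {..<q}"
  by (induction p arbitrary: i) auto

lemma digits_0: "digits q p 0 = replicate p 0"
  by (induction p) auto

lemma digits_surj:
  assumes "set ds \<subseteq> {..<q}"
  shows "\<exists>i < q ^ length ds. digits q (length ds) i = ds"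
  using assms
proof (induction ds)
  case (Cons c ds)
  then obtain i where i: "i < q ^ length ds" "digits q (length ds) i = ds"
    by auto
  have c: "c < q"
    using Cons.prems by simp
  have "c + q * i < q + q * i"
    using c by simp
  also have "\<dots> = q * Suc i"
    by simp
  also have "\<dots> \<le> q * q ^ length ds"
    using i(1) by (intro mult_le_mono) auto
  finally have "c + q * i < q ^ length (c # ds)"
    by simp
  moreover have "digits q (length (c # ds)) (c + q * i) = c # ds"
    using c i by simp
  ultimately show ?case by blast
qed simp

text \<open>One position of the increment: the state is the carry and the digits already processed.\<close>

definition incr_step :: "nat \<Rightarrow> nat \<Rightarrow> bool \<times> nat list \<Rightarrow> bool \<times> nat list" where
  "incr_step q c s = (if fst s then if Suc c = q then (True, snd s @ [0]) else (False, snd s @ [Suc c])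
     else (False, snd s @ [c]))"

definition incr :: "nat \<Rightarrow> nat list \<Rightarrow> bool \<times> nat list" where
  "incr q ds = fold (incr_step q) ds (True, [])"

lemma fold_incr_step_False: "fold (incr_step q) ds (False, acc) = (False, acc @ ds)"
  by (induction ds arbitrary: acc) (auto simp: incr_step_def)

text \<open>A carry leaves the last position exactly when the counter wraps around. In the search
  this marks the last candidate, so the carry can serve as the loop guard.\<close>

lemma incr_digits:
  assumes "0 < q"
  shows "incr q (digits q p i) = (q ^ p dvd Suc i, digits q p (Suc i))"
proof -
  have "fold (incr_step q) (digits q p i) (True, acc) = (q ^ p dvd Suc i, acc @ digits q p (Suc i))" for acc
  proof (induction p arbitrary: i acc)
    case (Suc p)
    show ?case
    proof (cases "Suc (i mod q) = q")
      case True
      then have i: "Suc i = q * Suc (i div q)"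
        by (metis add_Suc_right mult_Suc_right mult_div_mod_eq add.commute)
      then have "Suc i mod q = 0" "Suc i div q = Suc (i div q)"
        using assms by auto
      moreover have "q ^ Suc p dvd Suc i \<longleftrightarrow> q ^ p dvd Suc (i div q)"
        using assms unfolding i power_Suc by (subst nat_mult_dvd_cancel_disj) simp
      ultimately show ?thesis
        using True Suc.IH[of "i div q" "acc @ [0]"] by (simp add: incr_step_def)
    next
      case False
      then have m: "Suc i mod q = Suc (i mod q)" "Suc i div q = i div q"
        by (auto simp: mod_Suc div_Suc)
      then have "\<not> q dvd Suc i"
        by (metis dvd_imp_mod_0 nat.distinct(1))
      then have "\<not> q ^ Suc p dvd Suc i"
        by (metis dvd_mult_left power_Suc)
      moreover have "incr_step q (i mod q) (True, acc) = (False, acc @ [Suc (i mod q)])"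
        using False by (simp add: incr_step_def)
      ultimately show ?thesis
        using m by (simp add: fold_incr_step_False)
    qed
  qed simp
  from this[of "[]"] show ?thesis
    by (simp add: incr_def)
qed

lemma ptime_incr [ptime_intros]:
  assumes "ptime f"
  shows "ptime (\<lambda>x. incr q (f x))"
proof -
  have "ptime (\<lambda>x. fold (incr_step q) (f x) (True, []))"
  proof (rule ptime_fold)
    show "pbounded (\<lambda>e :: 'a \<times> nat. sz e + 5)"
      by (intro pbounded_add pbounded_sz pbounded_const)
    show "sz (incr_step q c s) \<le> sz s + (sz (x, c) + 5)" for c s and x :: 'a
      by (cases s) (simp add: incr_step_def)
    show "ptime (\<lambda>e. incr_step q (fst (snd e)) (snd (snd e)))" 
      unfolding incr_step_def by (intro ptime_intros)
  qed (intro ptime_intros assms)+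
  then show ?thesis by (simp add: incr_def)
qed

text \<open>Each of the \<open>q ^ length (pos x)\<close> rounds works on a state of polynomial
  size. The list \<open>pos x\<close> only supplies the number of digits; everything else that
  \<open>check\<close> needs is computed once, as \<open>env x\<close>.\<close>

lemma exhaustive_search:
  fixes env :: "'a :: repr \<Rightarrow> 'e :: repr" and pos :: "'a \<Rightarrow> 'b :: repr list"
  assumes "0 < q" "ptime env" "ptime pos" and check: "ptime (\<lambda>x. check (fst x) (snd x))"
  shows "\<exists>prog c d. \<forall>x. \<exists>t \<le> q ^ length (pos x) * (c * (sz x + 1) ^ d).
    exec prog (init_state (repr x)) t (init_state (repr
      (\<exists>ds. length ds = length (pos x) \<and> set ds \<subseteq> {..<q} \<and> check (env x) ds)))"
proof -
  define body where "body s = (\<not> fst (incr q (snd (fst (snd s)))),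
    (fst (fst (snd s)), snd (incr q (snd (fst (snd s))))),
    snd (snd s) \<or> check (fst (fst (snd s))) (snd (fst (snd s))))" for s :: "bool \<times> ('e \<times> nat list) \<times> bool"
  have "ptime body"
    unfolding body_def using ptime_comp[OF check, of "\<lambda>s. fst (snd s)"] by (intro ptime_intros) (simp add: ptime_intros)
  then obtain p c d where loop: "iterates p c d body"
    using ptime_iterates by blast
  define start where "start x = (True, (env x, map (\<lambda>_. 0 :: nat) (pos x)), False)" for x
  have ptime_start: "ptime start"
    unfolding start_def by (intro ptime_intros assms)
  then obtain p1 T1 where p1: "pbounded T1" "computes p1 T1 start"
    by (blast elim: ptimeE)
  define answer where "answer x = (\<exists>ds. length ds = length (pos x) \<and> set ds \<subseteq> {..<q} \<and> check (env x) ds)" for x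
  define final where "final x = (False, (env x, map (\<lambda>_. 0 :: nat) (pos x)), answer x)" for x
  have state: "(body ^^ i) (start x) = (i < q ^ length (pos x), (env x, digits q (length (pos x)) i),
      \<exists>j < i. check (env x) (digits q (length (pos x)) j))"
    if "i \<le> q ^ length (pos x)" for x i
    using that
  proof (induction i)
    case 0
    then show ?case
      using assms(1) by (simp add: start_def digits_0 map_replicate_const)
  next
    case (Suc i)
    have "q ^ length (pos x) dvd Suc i \<longleftrightarrow> \<not> Suc i < q ^ length (pos x)"
      using Suc.prems by (auto dest: dvd_imp_le)
    then show ?case
      using Suc assms(1) by (auto simp: body_def incr_digits less_Suc_eq)
  qed
  \<comment> \<open>After the last candidate the counter is back at zero, which determines the final
    state up to the answer.\<close>
  have "digits q p (q ^ p) = replicate p 0" for p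
    using assms(1) by (induction p) auto
  moreover have "(\<exists>j < q ^ length (pos x). check (env x) (digits q (length (pos x)) j)) = answer x" for x
    unfolding answer_def using digits_surj digits_less[OF assms(1)] by (metis length_digits)
  ultimately have final: "(body ^^ (q ^ length (pos x))) (start x) = final x" for x
    using state[OF order_refl, of x] by (simp add: final_def map_replicate_const)
  define b where "b x = sz (start x) + (length (pos x) * Suc q + 5)" for x
  have bounded: "pbounded (\<lambda>x. length (pos x))"
    using ptime_pbounded[OF assms(3)] by (rule pbounded_mono) (rule length_le_sz)
  \<comment> \<open>The factor 2 comes from bounding the number of rounds plus one by twice that
    number; the 4 is the cost of projecting to the answer.\<close>
  define T where "T x = T1 x + 2 * (c * (b x + 1) ^ d) + 4" for x
  have "pbounded T"
    unfolding T_def b_def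
    by (intro pbounded_add pbounded_mult pbounded_power pbounded_const bounded p1 ptime_pbounded ptime_start)
  then obtain C D where T: "\<And>x. T x \<le> C * (sz x + 1) ^ D"
    unfolding pbounded_def by blast
  let ?out = "Assign 0 (ETl (ETl (EVar 0)))"
  have "\<exists>t \<le> q ^ length (pos x) * (C * (sz x + 1) ^ D).
    exec (Seq p1 (Seq p ?out)) (init_state (repr x)) t (init_state (repr (answer x)))" for x
  proof -
    let ?N = "q ^ length (pos x)"
    obtain t1 where t1: "t1 \<le> T1 x" "exec p1 (init_state (repr x)) t1 (init_state (repr (start x)))"
      by (rule computesE[OF p1(2)])
    obtain t2 where t2: "t2 \<le> (?N + 1) * (c * (b x + 1) ^ d)"
      "exec p (init_state (repr (start x))) t2 (init_state (repr ((body ^^ ?N) (start x))))"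
    proof (rule iteratesE[OF loop, of ?N "start x" "b x"])
      show "repr (fst ((body ^^ i) (start x))) \<noteq> Nl" if "i < ?N" for i
        using that by (simp add: state)
      show "sz ((body ^^ i) (start x)) \<le> b x" if "i < ?N" for i
      proof -
        have "sz (digits q (length (pos x)) i) \<le> length (digits q (length (pos x)) i) * Suc q"
          by (rule sz_list_le) (use digits_less[OF assms(1)] in fastforce)
        moreover have "sz (\<exists>j < i. check (env x) (digits q (length (pos x)) j)) \<le> 1"
          by (rule sz_bool_le)
        ultimately show ?thesis
          unfolding state[OF less_imp_le[OF that]] using that by (simp add: b_def start_def)
      qed
    qed (simp add: final final_def)
    have t3: "exec ?out (init_state (repr (final x))) 4 (init_state (repr (answer x)))"
      by (intro exec_AssignI) (auto simp: final_def)
    have "exec (Seq p1 (Seq p ?out)) (init_state (repr x)) (t1 + (t2 + 4)) (init_state (repr (answer x)))"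
      by (rule exec.Seq[OF t1(2) exec.Seq[OF t2(2)[unfolded final] t3]])
    moreover have "t1 + (t2 + 4) \<le> ?N * (C * (sz x + 1) ^ D)"
    proof -
      have N: "1 \<le> ?N"
        using assms(1) by simp
      have "t1 + (t2 + 4) \<le> T1 x + ((?N + 1) * (c * (b x + 1) ^ d) + 4)"
        using t1 t2 by simp
      also have "\<dots> \<le> ?N * T1 x + ((?N + ?N) * (c * (b x + 1) ^ d) + ?N * 4)"
        using N by (intro add_mono mult_le_mono) auto
      also have "\<dots> = ?N * T x"
        by (simp add: T_def algebra_simps)
      also have "\<dots> \<le> ?N * (C * (sz x + 1) ^ D)"
        by (intro mult_le_mono T order_refl)
      finally show ?thesis .
    qed
    ultimately show ?thesis by blast
  qed
  then show ?thesis
    unfolding answer_def by blast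
qed

subsection \<open>Colorings of a graph with a hub\<close>

definition adj_lookup :: "bool list list \<Rightarrow> nat \<Rightarrow> nat \<Rightarrow> bool" where
  "adj_lookup A u v = nth_default False (nth_default [] A u) v"

text \<open>An association list stands for a partial coloring. It may give a repeated vertex several
  colors; this is harmless, because then every choice among them avoids conflicts.\<close>

definition proper :: "bool list list \<Rightarrow> (nat \<times> nat) list \<Rightarrow> bool" where
  "proper A cs \<longleftrightarrow> (\<forall>a \<in> set cs. \<forall>b \<in> set cs. adj_lookup A (fst a) (fst b) \<longrightarrow> snd a \<noteq> snd b)"

text \<open>No components are computed: a coloring of the hub extends to all components as soon as it
  extends to all tuples of \<open>\<sigma>\<close> vertices.\<close>

definition extendable :: "nat \<Rightarrow> nat \<Rightarrow> bool list list \<times> nat list \<times> nat list \<Rightarrow> nat list \<Rightarrow> bool" where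
  "extendable q \<sigma> e ds \<longleftrightarrow> proper (fst e) (zip (fst (snd e)) ds) \<and>
     (\<forall>vs \<in> set (List.n_lists \<sigma> (snd (snd e))). \<exists>cs \<in> set (List.n_lists \<sigma> [0..<q]).
        proper (fst e) (zip (fst (snd e)) ds @ zip vs cs))"

definition hub_vertices :: "bool list \<Rightarrow> nat list" where
  "hub_vertices h = filter (\<lambda>i. nth_default False h i) [0..<length h]"

definition other_vertices :: "bool list \<Rightarrow> nat list" where
  "other_vertices h = filter (\<lambda>i. \<not> nth_default False h i) [0..<length h]"

lemma ptime_proper [ptime_intros]:
  assumes "ptime f" "ptime g"
  shows "ptime (\<lambda>x. proper (f x) (g x))"
  unfolding proper_def adj_lookup_def
  by (intro ptime_intros ptime_comp[OF assms(1)] ptime_comp[OF assms(2)])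

lemma ptime_extendable: "ptime (\<lambda>x. extendable q \<sigma> (fst x) (snd x))"
  unfolding extendable_def by (intro ptime_intros)

lemma repr_map: "repr (map g xs) = enc_list (\<lambda>x. repr (g x)) xs"
  by (induction xs) auto

section \<open>Gluing colorings of the components outside the hub\<close>

lemma components_onI: "v \<in> W \<Longrightarrow> {(u, v). u \<in> W \<and> v \<in> W \<and> (u, v) \<in> (E \<inter> W \<times> W)\<^sup>*} `` {v} \<in> components_on W E"
  unfolding components_on_def by (rule quotientI)

lemma component_eq:
  assumes "sym E" "(u, v) \<in> E" "u \<in> W" "v \<in> W"
  shows "{(u, v). u \<in> W \<and> v \<in> W \<and> (u, v) \<in> (E \<inter> W \<times> W)\<^sup>*} `` {u} =
    {(u, v). u \<in> W \<and> v \<in> W \<and> (u, v) \<in> (E \<inter> W \<times> W)\<^sup>*} `` {v}"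
proof -
  have "(u, v) \<in> (E \<inter> W \<times> W)\<^sup>*" "(v, u) \<in> (E \<inter> W \<times> W)\<^sup>*"
    using assms by (auto dest: symD intro!: r_into_rtrancl)
  then show ?thesis
    using assms(3,4) by (auto intro: rtrancl_trans)
qed

text \<open>Selects a single color for each vertex even if \<open>vs\<close> has
  repetitions.\<close>

lemma zip_the_map_of:
  assumes "length vs = length cs" "v \<in> set vs"
  shows "(v, the (map_of (zip vs cs) v)) \<in> set (zip vs cs)"
proof -
  obtain c where c: "map_of (zip vs cs) v = Some c"
    using assms map_of_zip_is_Some by metis
  then have "(v, c) \<in> set (zip vs cs)"
    by (rule map_of_SomeD)
  then show ?thesis
    using c by simp
qed

text \<open>A component outside the hub fits into a \<open>\<sigma>\<close>-tuple. Every edge lies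
  within the hub together with a single component, so extensions chosen independently for the
  components form a coloring.\<close>

lemma extendable_iff_colorable:
  assumes G: "simple_graph {..<n} E" and hub: "is_hub \<sigma> \<delta> {..<n} E Q"
    and A: "\<And>u v. u < n \<Longrightarrow> v < n \<Longrightarrow> adj_lookup A u v \<longleftrightarrow> (u, v) \<in> E"
    and hubs: "set hubs = Q" and others: "set others = {..<n} - Q"
  shows "(\<exists>ds. length ds = length hubs \<and> set ds \<subseteq> {..<q} \<and> extendable q \<sigma> (A, hubs, others) ds)
    \<longleftrightarrow> colorable q {..<n} E"
proof
  assume "colorable q {..<n} E"
  then obtain f where f: "\<And>v. v < n \<Longrightarrow> f v \<in> {1..q}" "\<And>u v. (u, v) \<in> E \<Longrightarrow> f u \<noteq> f v"
    unfolding colorable_def by blast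
  \<comment> \<open>\<open>colorable\<close> uses the colors 1 to \<open>q\<close>, the odometer the
    digits 0 to \<open>q - 1\<close>.\<close>
  let ?F = "\<lambda>v. f v - 1"
  have Q: "Q \<subseteq> {..<n}"
    using hub by (simp add: is_hub_def)
  have F: "?F v < q" if "v < n" for v
    using f(1)[OF that] by auto
  have proper: "proper A cs" if cs: "\<And>v c. (v, c) \<in> set cs \<Longrightarrow> v < n \<and> c = ?F v" for cs
    unfolding proper_def
  proof (intro ballI impI)
    fix a b assume *: "a \<in> set cs" "b \<in> set cs" "adj_lookup A (fst a) (fst b)"
    have a: "fst a < n" "snd a = ?F (fst a)" and b: "fst b < n" "snd b = ?F (fst b)"
      using cs[of "fst a" "snd a"] cs[of "fst b" "snd b"] * by auto
    have "f (fst a) \<noteq> f (fst b)"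
      using A a b * f(2) by blast
    then show "snd a \<noteq> snd b"
      using a b f(1)[OF a(1)] f(1)[OF b(1)] by auto
  qed
  have zip: "(v, c) \<in> set (zip vs (map ?F vs)) \<Longrightarrow> v \<in> set vs \<and> c = ?F v" for v c vs
    by (induction vs) auto
  have "extendable q \<sigma> (A, hubs, others) (map ?F hubs)"
    unfolding extendable_def fst_conv snd_conv
  proof (intro conjI ballI)
    show "proper A (zip hubs (map ?F hubs))"
      by (intro proper) (use zip hubs Q in blast)
    fix vs assume vs: "vs \<in> set (List.n_lists \<sigma> others)"
    then have vs': "length vs = \<sigma>" "set vs \<subseteq> {..<n} - Q"
      using others by (auto simp: set_n_lists)
    show "\<exists>cs \<in> set (List.n_lists \<sigma> [0..<q]). proper A (zip hubs (map ?F hubs) @ zip vs cs)"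
    proof (rule bexI[of _ "map ?F vs"])
      show "map ?F vs \<in> set (List.n_lists \<sigma> [0..<q])"
        using vs' F by (auto simp: set_n_lists)
      show "proper A (zip hubs (map ?F hubs) @ zip vs (map ?F vs))"
      proof (intro proper)
        fix v c assume "(v, c) \<in> set (zip hubs (map ?F hubs) @ zip vs (map ?F vs))"
        then have "(v \<in> set hubs \<or> v \<in> set vs) \<and> c = ?F v"
          using zip[of v c hubs] zip[of v c vs] by auto
        then show "v < n \<and> c = ?F v"
          using hubs Q vs' by auto
      qed
    qed
  qed
  moreover have "set (map ?F hubs) \<subseteq> {..<q}"
    using hubs Q F by auto
  ultimately show "\<exists>ds. length ds = length hubs \<and> set ds \<subseteq> {..<q} \<and> extendable q \<sigma> (A, hubs, others) ds"
    by (intro exI[of _ "map ?F hubs"]) simp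
next
  assume "\<exists>ds. length ds = length hubs \<and> set ds \<subseteq> {..<q} \<and> extendable q \<sigma> (A, hubs, others) ds"
  then obtain ds where ds: "length ds = length hubs" "set ds \<subseteq> {..<q}"
    and ext: "extendable q \<sigma> (A, hubs, others) ds"
    by blast
  have proper_hub: "proper A (zip hubs ds)"
    using ext by (simp add: extendable_def)
  have ext: "\<exists>cs. length cs = \<sigma> \<and> set cs \<subseteq> {..<q} \<and> proper A (zip hubs ds @ zip vs cs)"
    if "length vs = \<sigma>" "set vs \<subseteq> {..<n} - Q" for vs
  proof -
    have "vs \<in> set (List.n_lists \<sigma> others)"
      using that by (simp add: set_n_lists others)
    then obtain cs where "cs \<in> set (List.n_lists \<sigma> [0..<q])" "proper A (zip hubs ds @ zip vs cs)"
      using ext unfolding extendable_def fst_conv snd_conv by blast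
    then show ?thesis
      by (intro exI[of _ cs]) (auto simp: set_n_lists)
  qed
  define W where "W = {..<n} - Q"
  define comp where "comp v = {(u, v). u \<in> W \<and> v \<in> W \<and> (u, v) \<in> (E \<inter> W \<times> W)\<^sup>*} `` {v}" for v
  have E: "E \<subseteq> {..<n} \<times> {..<n}" "sym E"
    using G by (auto simp: simple_graph_def)
  have Q: "Q \<subseteq> {..<n}"
    using hub by (simp add: is_hub_def)
  have tuple: "\<exists>vs. length vs = \<sigma> \<and> set vs = comp v" if "v \<in> W" for v
  proof -
    have sub: "comp v \<subseteq> W" "v \<in> comp v"
      using that by (auto simp: comp_def)
    then have fin: "finite (comp v)"
      by (auto simp: W_def intro: finite_subset)
    have card: "card (comp v) \<le> \<sigma>"
      using hub components_onI[OF that, of E] unfolding is_hub_def comp_def W_def by blast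
    obtain xs where xs: "set xs = comp v" "length xs = card (comp v)"
      using finite_distinct_list[OF fin] distinct_card by metis
    \<comment> \<open>Tuples have length exactly \<open>\<sigma>\<close>, so smaller components are
      padded by repeating \<open>v\<close>.\<close>
    let ?vs = "xs @ replicate (\<sigma> - card (comp v)) v"
    have "length ?vs = \<sigma>"
      using xs(2) card by simp
    moreover have "set ?vs = comp v"
      using sub(2) by (simp add: xs(1) set_replicate_conv_if insert_absorb)
    ultimately show ?thesis by blast
  qed
  have *: "\<exists>g. (\<forall>u \<in> comp v. g u < q) \<and> (\<exists>cs. proper A cs \<and> set (zip hubs ds) \<subseteq> set cs \<and> (\<forall>u \<in> comp v. (u, g u) \<in> set cs))"
    if "v \<in> W" for v
  proof -
    obtain vs where vs: "length vs = \<sigma>" "set vs = comp v"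
      using tuple[OF \<open>v \<in> W\<close>] by blast
    have "comp v \<subseteq> W"
      by (auto simp: comp_def)
    then obtain cs where cs: "length cs = \<sigma>" "set cs \<subseteq> {..<q}" "proper A (zip hubs ds @ zip vs cs)"
      using ext[of vs] vs unfolding W_def by blast
    define g where "g u = the (map_of (zip vs cs) u)" for u
    have g: "(u, g u) \<in> set (zip vs cs)" if "u \<in> comp v" for u
      unfolding g_def using vs cs that by (intro zip_the_map_of) auto
    then have "\<forall>u \<in> comp v. g u < q"
      using cs(2) by (auto dest!: set_zip_rightD)
    moreover have "\<forall>u \<in> comp v. (u, g u) \<in> set (zip hubs ds @ zip vs cs)"
      using g by auto
    ultimately show ?thesis
      using cs(3) by (intro exI[of _ g]) auto
  qed
  \<comment> \<open>The choice depends on the set \<open>comp v\<close>, not on \<open>v\<close>, so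
    all vertices of a component take their colors from the same extension.\<close>
  then obtain g where g: "\<And>v. v \<in> W \<Longrightarrow> (\<forall>u \<in> comp v. g (comp v) u < q) \<and>
    (\<exists>cs. proper A cs \<and> set (zip hubs ds) \<subseteq> set cs \<and> (\<forall>u \<in> comp v. (u, g (comp v) u) \<in> set cs))"
  proof -
    define P where "P C g \<longleftrightarrow> (\<forall>u \<in> C. g u < q) \<and>
      (\<exists>cs. proper A cs \<and> set (zip hubs ds) \<subseteq> set cs \<and> (\<forall>u \<in> C. (u, g u) \<in> set cs))" for C and g :: "nat \<Rightarrow> nat"
    have "P (comp v) (SOME g. P (comp v) g)" if "v \<in> W" for v
      using *[OF that] unfolding P_def[symmetric] by (rule someI_ex)
    then show ?thesis
      using that[of "\<lambda>C. SOME g. P C g"] unfolding P_def by blast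
  qed
  have refl: "v \<in> comp v" if "v \<in> W" for v
    using that by (auto simp: comp_def)
  define h where "h v = (if v \<in> Q then the (map_of (zip hubs ds) v) else g (comp v) v)" for v
  have hQ: "(v, h v) \<in> set (zip hubs ds)" if "v \<in> Q" for v
    unfolding h_def using zip_the_map_of[of hubs ds v] ds(1) hubs that by simp
  have less: "h v < q" if "v < n" for v
  proof (cases "v \<in> Q")
    case True
    then show ?thesis
      using hQ[OF True] ds(2) by (auto dest!: set_zip_rightD)
  next
    case False
    then have "v \<in> W"
      using that by (simp add: W_def)
    then show ?thesis
      using g refl False by (simp add: h_def)
  qed
  have diff: "h u \<noteq> h v" if uv: "(u, v) \<in> E" for u v
  proof -
    have n: "u < n" "v < n"
      using uv E by auto
    \<comment> \<open>It suffices that both ends of the edge receive their colors within one proper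
      list.\<close>
    have main: "\<exists>cs. proper A cs \<and> (u, h u) \<in> set cs \<and> (v, h v) \<in> set cs"
    proof (cases "u \<in> Q \<and> v \<in> Q")
      case True
      then show ?thesis
        using proper_hub hQ by blast
    next
      case False
      then obtain w where w: "w \<in> W" "u \<in> Q \<or> u \<in> W \<and> comp u = comp w" "v \<in> Q \<or> v \<in> W \<and> comp v = comp w"
      proof (cases "u \<in> Q")
        case True
        then show ?thesis
          using that[of v] False n by (auto simp: W_def)
      next
        case u: False
        have "comp u = comp v" if "v \<in> W"
          unfolding comp_def by (rule component_eq[OF E(2) uv _ that]) (use u n in \<open>simp add: W_def\<close>)
        then show ?thesis
          using that[of u] u n by (auto simp: W_def)
      qed
      obtain cs where cs: "proper A cs" "set (zip hubs ds) \<subseteq> set cs"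
        "\<forall>u \<in> comp w. (u, g (comp w) u) \<in> set cs"
        using g[OF w(1)] by blast
      have "(x, h x) \<in> set cs" if "x \<in> Q \<or> x \<in> W \<and> comp x = comp w" for x
      proof (cases "x \<in> Q")
        case True
        then show ?thesis using hQ cs(2) by blast
      next
        case False
        then show ?thesis
          using that cs(3) refl[of x] by (auto simp: h_def)
      qed
      then show ?thesis
        using cs(1) w by blast
    qed
    then obtain cs where "proper A cs" "(u, h u) \<in> set cs" "(v, h v) \<in> set cs"
      by blast
    then show ?thesis
      using A[OF n] uv unfolding proper_def by fastforce
  qed
  show "colorable q {..<n} E"
    unfolding colorable_def
    by (rule exI[of _ "\<lambda>v. Suc (h v)"]) (use less diff in \<open>auto simp: Suc_le_eq\<close>)
qed

lemma enc_graph_hub_eq_repr: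
  "enc_graph_hub n E Q = repr (map (\<lambda>u. map (\<lambda>v. (u, v) \<in> E) [0..<n]) [0..<n], map (\<lambda>v. v \<in> Q) [0..<n])"
proof -
  have "enc_bool b = repr b" for b
    by (cases b) auto
  then show ?thesis
    by (simp add: enc_graph_hub_def repr_map)
qed

lemma coloring_algorithm:
  assumes "0 < q"
  shows "\<exists>prog (c::nat) (d::nat). \<forall>n E Q p.
    simple_graph {..<n} E \<and> is_hub \<sigma> \<delta> {..<n} E Q \<and> card Q = p \<longrightarrow>
      decides_within prog (enc_graph_hub n E Q) (colorable q {..<n} E)
        (real q ^ p * (real c * real (n + 1) ^ d))"
proof -
  define env where "env x = (fst x, hub_vertices (snd x), other_vertices (snd x))" for x :: "bool list list \<times> bool list"
  define pos where "pos x = hub_vertices (snd x)" for x :: "bool list list \<times> bool list"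
  have 1: "ptime env" "ptime pos"
    unfolding env_def pos_def hub_vertices_def other_vertices_def by (intro ptime_intros)+
  obtain prog c d where search: "\<And>x. \<exists>t \<le> q ^ length (pos x) * (c * (sz x + 1) ^ d).
    exec prog (init_state (repr x)) t (init_state (repr
      (\<exists>ds. length ds = length (pos x) \<and> set ds \<subseteq> {..<q} \<and> extendable q \<sigma> (env x) ds)))"
    using exhaustive_search[OF assms 1 ptime_extendable[of q \<sigma>]] by blast
  \<comment> \<open>The adjacency matrix makes the input quadratic in \<open>n\<close>: its size
    plus one is at most \<open>4 * (n + 1) ^ 2\<close>, whence \<open>4 ^ d\<close> and
    \<open>2 * d\<close>.\<close>
  have "decides_within prog (enc_graph_hub n E Q) (colorable q {..<n} E)
      (real q ^ p * (real (c * 4 ^ d) * real (n + 1) ^ (2 * d)))"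
    if G: "simple_graph {..<n} E" and hub: "is_hub \<sigma> \<delta> {..<n} E Q" and p: "card Q = p" for n E Q p
  proof -
    define A where "A = map (\<lambda>u. map (\<lambda>v. (u, v) \<in> E) [0..<n]) [0..<n]"
    define h where "h = map (\<lambda>v. v \<in> Q) [0..<n]"
    have Q: "Q \<subseteq> {..<n}"
      using hub by (simp add: is_hub_def)
    have hubs: "set (hub_vertices h) = Q" "distinct (hub_vertices h)" "set (other_vertices h) = {..<n} - Q"
      using Q by (auto simp: hub_vertices_def other_vertices_def h_def nth_default_nth)
    have len: "length (pos (A, h)) = p"
      using hubs(1,2) p by (simp add: pos_def distinct_card[symmetric])
    have "adj_lookup A u v \<longleftrightarrow> (u, v) \<in> E" if "u < n" "v < n" for u v
      using that by (simp add: adj_lookup_def A_def nth_default_nth)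
    from extendable_iff_colorable[OF G hub this hubs(1,3)]
    have ans: "(\<exists>ds. length ds = length (pos (A, h)) \<and> set ds \<subseteq> {..<q} \<and> extendable q \<sigma> (env (A, h)) ds) =
      colorable q {..<n} E"
      by (simp add: pos_def env_def)
    have row: "sz (map f [0..<n]) \<le> n * 2" for f :: "nat \<Rightarrow> bool"
      using sz_list_le[of "map f [0..<n]" 1] sz_bool_le by (simp add: numeral_2_eq_2)
    have "sz A \<le> n * Suc (n * 2)"
      using sz_list_le[of A "n * 2"] row by (auto simp: A_def)
    moreover have "sz h \<le> n * 2"
      unfolding h_def by (rule row)
    ultimately have "sz (A, h) + 1 \<le> 4 * (n + 1) ^ 2"
      by (simp add: power2_eq_square algebra_simps)
    then have "(sz (A, h) + 1) ^ d \<le> (4 * (n + 1) ^ 2) ^ d"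
      by (rule power_mono) simp
    also have "\<dots> = 4 ^ d * (n + 1) ^ (2 * d)"
      by (simp add: power_mult_distrib power_mult)
    finally have le: "q ^ p * (c * (sz (A, h) + 1) ^ d) \<le> q ^ p * (c * (4 ^ d * (n + 1) ^ (2 * d)))"
      by (intro mult_le_mono order_refl)
    have bound: "real t \<le> real q ^ p * (real (c * 4 ^ d) * real (n + 1) ^ (2 * d))"
      if "t \<le> q ^ p * (c * (sz (A, h) + 1) ^ d)" for t
    proof -
      have "real t \<le> real (q ^ p * (c * (4 ^ d * (n + 1) ^ (2 * d))))"
        by (intro of_nat_mono order_trans[OF that le])
      then show ?thesis by (simp add: mult_ac)
    qed
    obtain t where t: "t \<le> q ^ p * (c * (sz (A, h) + 1) ^ d)"
      "exec prog (init_state (repr (A, h))) t (init_state (repr (colorable q {..<n} E)))"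
      using search[of "(A, h)"] unfolding len ans[unfolded len] by (elim exE conjE) (rule that)
    have "repr (colorable q {..<n} E) = enc_bool (colorable q {..<n} E)"
      by (simp add: repr_bool_def)
    then show ?thesis
      unfolding decides_within_def enc_graph_hub_eq_repr A_def[symmetric] h_def[symmetric] init_state_def[symmetric]
      using t bound by (intro exI[of _ t] exI[of _ "init_state (repr (colorable q {..<n} E))"]) simp
  qed
  then show ?thesis by blast
qed


section \<open>The reduction\<close>

subsection \<open>Graphs given by a vertex list and an adjacency predicate\<close>

text \<open>Gadget vertices carry structure, whereas instances live on an initial segment of the
  numbers; a vertex is renamed to its position in the list.\<close>

definition index_edges :: "('v \<Rightarrow> 'v \<Rightarrow> bool) \<Rightarrow> 'v list \<Rightarrow> (nat \<times> nat) set" where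
  "index_edges adj vs = {(i, j). i < length vs \<and> j < length vs \<and> adj (vs ! i) (vs ! j)}"

definition index_set :: "('v \<Rightarrow> bool) \<Rightarrow> 'v list \<Rightarrow> nat set" where
  "index_set P vs = {i. i < length vs \<and> P (vs ! i)}"

lemma simple_graph_index:
  assumes "\<And>u v. adj u v \<Longrightarrow> adj v u" "\<And>v. \<not> adj v v"
  shows "simple_graph {..<length vs} (index_edges adj vs)"
  using assms by (auto simp: simple_graph_def index_edges_def sym_def irrefl_def)

lemma card_index_set: "card (index_set P vs) = length (filter P vs)"
  by (simp add: index_set_def length_filter_conv_card)

lemma enc_graph_hub_index:
  "enc_graph_hub (length vs) (index_edges adj vs) (index_set P vs) =
    repr (map (\<lambda>u. map (adj u) vs) vs, map P vs)"
proof -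
  have "map (\<lambda>u. map (\<lambda>v. (u, v) \<in> index_edges adj vs) [0..<length vs]) [0..<length vs] =
      map (\<lambda>u. map (adj u) vs) vs"
    by (intro nth_equalityI) (auto simp: index_edges_def)
  moreover have "map (\<lambda>v. v \<in> index_set P vs) [0..<length vs] = map P vs"
    by (intro nth_equalityI) (auto simp: index_set_def)
  ultimately show ?thesis
    unfolding enc_graph_hub_eq_repr by simp
qed

lemma colorable_index_iff:
  assumes "distinct vs"
  shows "colorable q {..<length vs} (index_edges adj vs) \<longleftrightarrow>
    (\<exists>f. (\<forall>v \<in> set vs. f v \<in> {1..q}) \<and> (\<forall>u \<in> set vs. \<forall>v \<in> set vs. adj u v \<longrightarrow> f u \<noteq> f v))"
proof
  assume "colorable q {..<length vs} (index_edges adj vs)"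
  then obtain f where f: "\<And>i. i < length vs \<Longrightarrow> f i \<in> {1..q}"
    "\<And>i j. (i, j) \<in> index_edges adj vs \<Longrightarrow> f i \<noteq> f j"
    unfolding colorable_def by blast
  define pos where "pos v = (THE i. i < length vs \<and> vs ! i = v)" for v
  have pos: "pos (vs ! i) = i" if "i < length vs" for i
    unfolding pos_def using assms that by (auto simp: nth_eq_iff_index_eq)
  have "f (pos v) \<in> {1..q}" if "v \<in> set vs" for v
    using that f(1) pos by (metis in_set_conv_nth)
  moreover have "f (pos u) \<noteq> f (pos v)" if uv: "u \<in> set vs" "v \<in> set vs" "adj u v" for u v
  proof -
    obtain i j where "u = vs ! i" "v = vs ! j" "i < length vs" "j < length vs"
      using uv(1,2) by (auto simp: in_set_conv_nth)
    then show ?thesis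
      using f(2)[of i j] uv(3) by (simp add: index_edges_def pos)
  qed
  ultimately show "\<exists>f. (\<forall>v \<in> set vs. f v \<in> {1..q}) \<and> (\<forall>u \<in> set vs. \<forall>v \<in> set vs. adj u v \<longrightarrow> f u \<noteq> f v)"
    by (intro exI[of _ "\<lambda>v. f (pos v)"] conjI ballI impI)
next
  assume "\<exists>f. (\<forall>v \<in> set vs. f v \<in> {1..q}) \<and> (\<forall>u \<in> set vs. \<forall>v \<in> set vs. adj u v \<longrightarrow> f u \<noteq> f v)"
  then obtain f where "\<forall>v \<in> set vs. f v \<in> {1..q}" "\<forall>u \<in> set vs. \<forall>v \<in> set vs. adj u v \<longrightarrow> f u \<noteq> f v"
    by blast
  then show "colorable q {..<length vs} (index_edges adj vs)"
    unfolding colorable_def by (intro exI[of _ "\<lambda>i. f (vs ! i)"]) (auto simp: index_edges_def)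
qed

lemma card_index_le:
  assumes "distinct vs" "finite B" "card B \<le> b" "\<And>i. i \<in> I \<Longrightarrow> i < length vs \<and> vs ! i \<in> B"
  shows "card I \<le> b"
proof -
  have "inj_on ((!) vs) I"
    using assms(1,4) by (auto simp: inj_on_def nth_eq_iff_index_eq)
  moreover have "(!) vs ` I \<subseteq> B"
    using assms(4) by auto
  ultimately have "card I \<le> card B"
    using assms(2) card_inj_on_le by blast
  then show ?thesis
    using assms(3) by simp
qed

text \<open>Since \<open>key\<close> is constant along edges outside the hub, each component lies in
  one class of equal keys. Bounding these classes avoids computing the components.\<close>

lemma is_hub_indexI:
  assumes "distinct vs"
    and key: "\<And>u v. u \<in> set vs \<Longrightarrow> v \<in> set vs \<Longrightarrow> adj u v \<Longrightarrow> \<not> P u \<Longrightarrow> \<not> P v \<Longrightarrow> key u = key v"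
    and small: "\<And>w. w \<in> set vs \<Longrightarrow> \<not> P w \<Longrightarrow> card {v \<in> set vs. \<not> P v \<and> key v = key w} \<le> \<sigma>"
    and nbrs: "\<And>w. w \<in> set vs \<Longrightarrow> \<not> P w \<Longrightarrow>
      card {v \<in> set vs. P v \<and> (\<exists>u \<in> set vs. \<not> P u \<and> key u = key w \<and> adj u v)} \<le> \<delta>"
  shows "is_hub \<sigma> \<delta> {..<length vs} (index_edges adj vs) (index_set P vs)"
  unfolding is_hub_def
proof (intro conjI ballI)
  show "index_set P vs \<subseteq> {..<length vs}"
    by (auto simp: index_set_def)
  let ?W = "{..<length vs} - index_set P vs" and ?E = "index_edges adj vs"
  fix C assume "C \<in> components_on ?W ?E"
  then obtain w where w: "w \<in> ?W" "C = {(u, v). u \<in> ?W \<and> v \<in> ?W \<and> (u, v) \<in> (?E \<inter> ?W \<times> ?W)\<^sup>*} `` {w}"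
    unfolding components_on_def by (rule quotientE)
  have w': "w < length vs" "\<not> P (vs ! w)"
    using w(1) by (auto simp: index_set_def)
  have key_eq: "key (vs ! v) = key (vs ! w)" if "(w, v) \<in> (?E \<inter> ?W \<times> ?W)\<^sup>*" for v
    using that
  proof (induction rule: rtrancl_induct)
    case (step y z)
    then have "key (vs ! y) = key (vs ! z)"
      by (intro key[of "vs ! y" "vs ! z"]) (auto simp: index_edges_def index_set_def)
    then show ?case
      using step.IH by simp
  qed simp
  have C: "v < length vs \<and> \<not> P (vs ! v) \<and> key (vs ! v) = key (vs ! w)" if "v \<in> C" for v
  proof -
    have "v \<in> ?W" "(w, v) \<in> (?E \<inter> ?W \<times> ?W)\<^sup>*"
      using that unfolding w(2) by auto
    then show ?thesis
      using key_eq[of v] by (auto simp: index_set_def)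
  qed
  show "card C \<le> \<sigma>"
    by (rule card_index_le[OF assms(1) _ small[of "vs ! w"]]) (use w' C in auto)
  show "card {v \<in> index_set P vs. \<exists>u \<in> C. (u, v) \<in> ?E} \<le> \<delta>"
  proof (rule card_index_le[OF assms(1) _ nbrs[of "vs ! w"]])
    fix i assume "i \<in> {v \<in> index_set P vs. \<exists>u \<in> C. (u, v) \<in> ?E}"
    then show "i < length vs \<and> vs ! i \<in> {v \<in> set vs. P v \<and> (\<exists>u \<in> set vs. \<not> P u \<and> key u = key (vs ! w) \<and> adj u v)}"
      using C by (fastforce simp: index_set_def index_edges_def)
  qed (use w' in auto)
qed

subsection \<open>The gadget graph\<close>

text \<open>A pattern is a list of pairs of a hub vertex \<open>s\<close> and a color \<open>a\<close>; its gadget forbids that all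
  of these hub vertices have the given colors. A vertex \<open>(\<kappa>, p, i)\<close> has the kind \<open>\<kappa>\<close>:
  kind 0 is the palette vertex of color \<open>i\<close>, kind 1 is the hub vertex \<open>s\<close> if \<open>p = [(s, 0)]\<close>, and the
  kinds 2 to 5 form the gadget of the pattern \<open>p\<close>. The vertices of kind 2 have color 0 or 1 and
  record whether one of the first \<open>i\<close> entries of \<open>p\<close> is violated, starting with 0 and ending with 1.
  If entry \<open>i\<close> is satisfied then the vertices of kind 3 and 4 are forced, the latter to color 2, and
  the vertex of kind 5 then prevents the record from changing at \<open>i\<close>.\<close>

type_synonym site = "nat \<times> nat"
type_synonym pattern = "(site \<times> nat) list"
type_synonym vertex = "nat \<times> pattern \<times> nat"

definition entry :: "pattern \<Rightarrow> nat \<Rightarrow> site \<times> nat" where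
  "entry p i = nth_default ((0, 0), 0) p i"

text \<open>The result also differs from 2, the color reserved for signalling a satisfied
  entry.\<close>

definition other_color :: "nat \<Rightarrow> nat" where
  "other_color a = (if a = 0 then 1 else 0)"

text \<open>These are color lists, enforced by edges to the palette vertices of all other colors.
  For the empty pattern the vertex of kind 2 is first and last at once and has an empty list, so an
  empty clause makes the graph uncolorable, as it should.\<close>

definition allowed :: "vertex \<Rightarrow> nat \<Rightarrow> bool" where
  "allowed v c \<longleftrightarrow>
     fst v = 2 \<and> (c = 0 \<and> snd (snd v) \<noteq> length (fst (snd v)) \<or> c = 1 \<and> snd (snd v) \<noteq> 0) \<or>
     fst v = 3 \<and> (c = snd (entry (fst (snd v)) (snd (snd v))) \<or>
       c = other_color (snd (entry (fst (snd v)) (snd (snd v))))) \<or>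
     fst v = 4 \<and> (c = other_color (snd (entry (fst (snd v)) (snd (snd v)))) \<or> c = 2) \<or>
     fst v = 5 \<and> (c = 0 \<or> c = 1 \<or> c = 2)"

definition arc :: "vertex \<Rightarrow> vertex \<Rightarrow> bool" where
  "arc u v \<longleftrightarrow>
     fst u = 0 \<and> fst v = 0 \<and> snd (snd u) \<noteq> snd (snd v) \<or>
     fst u \<noteq> 0 \<and> fst u \<noteq> 1 \<and> fst v = 0 \<and> \<not> allowed u (snd (snd v)) \<or>
     fst u = 3 \<and> fst v = 1 \<and> fst (entry (fst (snd u)) (snd (snd u))) = fst (entry (fst (snd v)) 0) \<or>
     fst u = 3 \<and> fst v = 4 \<and> snd u = snd v \<or>
     fst u = 5 \<and> fst v = 4 \<and> snd u = snd v \<or>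
     fst u = 5 \<and> fst v = 2 \<and> fst (snd u) = fst (snd v) \<and>
       (snd (snd v) = snd (snd u) \<or> snd (snd v) = Suc (snd (snd u)))"

definition adjacent :: "vertex \<Rightarrow> vertex \<Rightarrow> bool" where
  "adjacent u v \<longleftrightarrow> arc u v \<or> arc v u"

definition in_hub :: "vertex \<Rightarrow> bool" where
  "in_hub v \<longleftrightarrow> fst v = 0 \<or> fst v = 1"

definition gadget :: "pattern \<Rightarrow> vertex list" where
  "gadget p = concat (map (\<lambda>i. [(2, p, i), (3, p, i), (4, p, i), (5, p, i)]) [0..<length p]) @ [(2, p, length p)]"

definition vertices :: "nat \<Rightarrow> nat \<Rightarrow> nat \<Rightarrow> pattern list \<Rightarrow> vertex list" where
  "vertices q t m ps = map (\<lambda>c. (0, [], c)) [0..<q] @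
     concat (map (\<lambda>j. map (\<lambda>i. (1, [((j, i), 0)], 0)) [0..<t]) [0..<m]) @ concat (map gadget ps)"

lemma set_gadget: "set (gadget p) = {(k, p, i) |k i. 2 \<le> k \<and> k \<le> 5 \<and> i < length p} \<union> {(2, p, length p)}"
proof -
  have "2 \<le> k \<and> k \<le> 5 \<longleftrightarrow> k = 2 \<or> k = 3 \<or> k = 4 \<or> k = 5" for k :: nat
    by auto
  then show ?thesis
    unfolding gadget_def by auto
qed

lemma set_vertices:
  "set (vertices q t m ps) = {(0, [], c) |c. c < q} \<union> {(1, [((j, i), 0)], 0) |j i. j < m \<and> i < t} \<union>
     (\<Union>p \<in> set ps. set (gadget p))"
  by (auto simp: vertices_def)

lemma length_gadget: "length (gadget p) = 4 * length p + 1"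
  by (simp add: gadget_def length_concat comp_def sum_list_triv)

lemma distinct_concat_map:
  assumes "distinct xs" "\<And>x. x \<in> set xs \<Longrightarrow> distinct (f x)"
    "\<And>x y. x \<in> set xs \<Longrightarrow> y \<in> set xs \<Longrightarrow> x \<noteq> y \<Longrightarrow> set (f x) \<inter> set (f y) = {}"
  shows "distinct (concat (map f xs))"
  using assms by (induction xs) fastforce+

lemma distinct_gadget: "distinct (gadget p)"
proof -
  have "distinct (concat (map (\<lambda>i. [(2 :: nat, p, i), (3, p, i), (4, p, i), (5, p, i)]) [0..<length p]))"
    by (rule distinct_concat_map) auto
  then show ?thesis
    by (auto simp: gadget_def)
qed

lemma distinct_vertices:
  assumes "distinct ps"
  shows "distinct (vertices q t m ps)"
proof -
  have "distinct (concat (map (\<lambda>j. map (\<lambda>i. (1 :: nat, [((j, i), 0 :: nat)], 0 :: nat)) [0..<t]) [0..<m]))"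
    by (rule distinct_concat_map) (auto simp: distinct_map inj_on_def)
  moreover have "distinct (concat (map gadget ps))"
    by (rule distinct_concat_map) (auto simp: assms distinct_gadget set_gadget)
  ultimately show ?thesis
    unfolding vertices_def by (auto simp: distinct_map inj_on_def set_gadget)
qed

lemma adjacent_sym: "adjacent u v \<Longrightarrow> adjacent v u"
  by (auto simp: adjacent_def)

lemma adjacent_irrefl: "\<not> adjacent v v"
  by (auto simp: adjacent_def arc_def)

lemma card_hub: "length (filter in_hub (vertices q t m ps)) = q + m * t"
proof -
  have "filter in_hub (concat (map gadget ps)) = []"
    by (auto simp: filter_empty_conv set_gadget in_hub_def)
  moreover have "filter in_hub (map (\<lambda>c. (0, [], c)) [0..<q]) = map (\<lambda>c. (0, [], c)) [0..<q]"
    by (auto simp: filter_id_conv in_hub_def)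
  moreover have "filter in_hub (concat (map (\<lambda>j. map (\<lambda>i. (1, [((j, i), 0)], 0)) [0..<t]) [0..<m])) =
      concat (map (\<lambda>j. map (\<lambda>i. (1, [((j, i), 0)], 0)) [0..<t]) [0..<m])"
    by (auto simp: filter_id_conv in_hub_def)
  moreover have "sum_list (map (\<lambda>_. t) [0..<m]) = m * t"
    by (induction m) auto
  ultimately show ?thesis
    by (simp add: vertices_def length_concat comp_def)
qed

text \<open>Edges outside the hub stay within one gadget, so the pattern serves as the key. A gadget
  has 4 vertices per entry and a last record, and it sees at most the \<open>q\<close> palette
  vertices and one hub vertex per entry.\<close>

lemma is_hub_vertices:
  assumes "distinct ps" "\<And>p. p \<in> set ps \<Longrightarrow> length p \<le> b"
  shows "is_hub (4 * b + 1) (q + b) {..<length (vertices q t m ps)}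
    (index_edges adjacent (vertices q t m ps)) (index_set in_hub (vertices q t m ps))"
proof (rule is_hub_indexI[OF distinct_vertices[OF assms(1)], where key = "\<lambda>v. fst (snd v)"])
  show "fst (snd u) = fst (snd v)" if "adjacent u v" "\<not> in_hub u" "\<not> in_hub v" for u v
    using that by (auto simp: adjacent_def arc_def in_hub_def)
  fix w assume w: "w \<in> set (vertices q t m ps)" "\<not> in_hub w"
  define p where "p = fst (snd w)"
  have p: "p \<in> set ps"
    using w by (auto simp: p_def set_vertices set_gadget in_hub_def)
  have "{v \<in> set (vertices q t m ps). \<not> in_hub v \<and> fst (snd v) = p} \<subseteq> set (gadget p)"
    by (auto simp: set_vertices set_gadget in_hub_def)
  then have "card {v \<in> set (vertices q t m ps). \<not> in_hub v \<and> fst (snd v) = p} \<le> card (set (gadget p))"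
    by (intro card_mono) auto
  also have "\<dots> \<le> 4 * b + 1"
    using card_length[of "gadget p"] assms(2)[OF p] by (simp add: length_gadget)
  finally show "card {v \<in> set (vertices q t m ps). \<not> in_hub v \<and> fst (snd v) = fst (snd w)} \<le> 4 * b + 1"
    by (simp add: p_def)
  let ?N = "{v \<in> set (vertices q t m ps). in_hub v \<and>
    (\<exists>u \<in> set (vertices q t m ps). \<not> in_hub u \<and> fst (snd u) = fst (snd w) \<and> adjacent u v)}"
  let ?L = "map (\<lambda>c. (0, [], c)) [0..<q] @ map (\<lambda>e. (1, [(fst e, 0)], 0)) p :: vertex list"
  have "?N \<subseteq> set ?L"
  proof
    fix v assume "v \<in> ?N"
    then obtain u where u: "v \<in> set (vertices q t m ps)" "in_hub v" "u \<in> set (vertices q t m ps)"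
      "\<not> in_hub u" "fst (snd u) = p" "adjacent u v"
      by (auto simp: p_def)
    show "v \<in> set ?L"
    proof (cases "fst v = 0")
      case True
      then show ?thesis
        using u(1) by (auto simp: set_vertices set_gadget)
    next
      case False
      then obtain j i where v: "v = (1, [((j, i), 0)], 0)"
        using u(1,2) by (auto simp: set_vertices set_gadget in_hub_def)
      have "fst u = 3" and e: "fst (entry p (snd (snd u))) = (j, i)"
        using u v by (auto simp: adjacent_def arc_def in_hub_def entry_def nth_default_def)
      then have "snd (snd u) < length p"
        using u by (auto simp: set_vertices set_gadget)
      then have "entry p (snd (snd u)) \<in> set p"
        by (simp add: entry_def nth_default_nth)
      then show ?thesis
        using e v by force
    qed
  qed
  then have "card ?N \<le> card (set ?L)"
    by (intro card_mono) auto
  also have "\<dots> \<le> q + b"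
    using card_length[of ?L] assms(2)[OF p] by simp
  finally show "card ?N \<le> q + b" .
qed

text \<open>If all entries were satisfied, the record color 0 would propagate from the first record
  to the last, where 0 is not admissible.\<close>

lemma gadget_sound:
  assumes p: "set (gadget p) \<subseteq> V" and site: "\<And>s a. (s, a) \<in> set p \<Longrightarrow> (1, [(s, 0)], 0) \<in> V"
    and proper: "\<And>u v. u \<in> V \<Longrightarrow> v \<in> V \<Longrightarrow> adjacent u v \<Longrightarrow> \<chi> u \<noteq> \<chi> v"
    and allowed: "\<And>v. v \<in> set (gadget p) \<Longrightarrow> allowed v (\<chi> v)"
  shows "\<exists>(s, a) \<in> set p. \<chi> (1, [(s, 0)], 0) \<noteq> a"
proof (rule ccontr)
  assume "\<not> ?thesis"
  then have all: "\<chi> (1, [(s, 0)], 0) = a" if "(s, a) \<in> set p" for s a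
    using that by auto
  have "\<chi> (2, p, i) = 0" if "i \<le> length p" for i
    using that
  proof (induction i)
    case 0
    \<comment> \<open>For \<open>p = []\<close> this vertex has no admissible color, so the
      hypothesis \<open>allowed\<close> is already contradictory.\<close>
    then show ?case
      using allowed[of "(2, p, 0)"] by (cases p) (auto simp: set_gadget allowed_def)
  next
    case (Suc i)
    have V: "(k, p, i) \<in> set (gadget p)" if "2 \<le> k" "k \<le> 5" for k
      using Suc.prems that by (auto simp: set_gadget)
    have V': "(2, p, Suc i) \<in> set (gadget p)"
      using Suc.prems by (cases "Suc i = length p") (auto simp: set_gadget)
    obtain s a where e: "entry p i = (s, a)" "(s, a) \<in> set p"
      using Suc.prems by (cases "p ! i") (auto simp: entry_def nth_default_nth in_set_conv_nth Suc_le_eq)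
    have "entry [(s, 0)] 0 = (s, 0)"
      by (simp add: entry_def nth_default_def)
    then have "\<chi> (3, p, i) \<noteq> a"
      using proper[of "(3, p, i)" "(1, [(s, 0)], 0)"] all site e V[of 3] p
      by (auto simp: adjacent_def arc_def)
    then have "\<chi> (3, p, i) = other_color a"
      using allowed[OF V[of 3]] e by (auto simp: allowed_def)
    moreover have "\<chi> (3, p, i) \<noteq> \<chi> (4, p, i)"
      using proper[of "(3, p, i)" "(4, p, i)"] V[of 3] V[of 4] p by (auto simp: adjacent_def arc_def)
    ultimately have 4: "\<chi> (4, p, i) = 2"
      using allowed[OF V[of 4]] e by (auto simp: allowed_def)
    have "\<chi> (5, p, i) \<noteq> \<chi> (4, p, i)" "\<chi> (5, p, i) \<noteq> \<chi> (2, p, i)"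
      using proper[of "(5, p, i)" "(4, p, i)"] proper[of "(5, p, i)" "(2, p, i)"] V[of 5] V[of 4] V[of 2] p
      by (auto simp: adjacent_def arc_def)
    then have "\<chi> (5, p, i) = 1"
      using allowed[OF V[of 5]] 4 Suc by (auto simp: allowed_def)
    moreover have "\<chi> (5, p, i) \<noteq> \<chi> (2, p, Suc i)"
      using proper[of "(5, p, i)" "(2, p, Suc i)"] V[of 5] V' p by (auto simp: adjacent_def arc_def)
    ultimately show ?case
      using allowed[OF V'] by (auto simp: allowed_def)
  qed
  then show False
    using allowed[of "(2, p, length p)"] by (auto simp: set_gadget allowed_def)
qed

section \<open>Coloring a gadget whose pattern is violated\<close>

definition satisfied :: "(site \<Rightarrow> nat) \<Rightarrow> pattern \<Rightarrow> nat \<Rightarrow> bool" where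
  "satisfied x p i \<longleftrightarrow> x (fst (entry p i)) = snd (entry p i)"

definition record_color :: "(site \<Rightarrow> nat) \<Rightarrow> pattern \<Rightarrow> nat \<Rightarrow> nat" where
  "record_color x p i = (if \<exists>j < i. \<not> satisfied x p j then 1 else 0)"

definition flag_color :: "(site \<Rightarrow> nat) \<Rightarrow> pattern \<Rightarrow> nat \<Rightarrow> nat" where
  "flag_color x p i = (if satisfied x p i then 2 else other_color (snd (entry p i)))"

definition free_color :: "(site \<Rightarrow> nat) \<Rightarrow> pattern \<Rightarrow> nat \<Rightarrow> nat" where
  "free_color x p i = (SOME c. c \<le> 2 \<and> c \<noteq> record_color x p i \<and> c \<noteq> record_color x p (Suc i) \<and> c \<noteq> flag_color x p i)"

definition extended_color :: "(site \<Rightarrow> nat) \<Rightarrow> vertex \<Rightarrow> nat" where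
  "extended_color x v = (case v of (k, p, i) \<Rightarrow>
     if k = 0 then i else if k = 1 then x (fst (entry p 0)) else if k = 2 then record_color x p i
     else if k = 3 then (if satisfied x p i then other_color (snd (entry p i)) else snd (entry p i))
     else if k = 4 then flag_color x p i else free_color x p i)"

text \<open>The vertex of kind 5 has three gadget neighbors and three colors. Either the record does
  not change and at most two colors are taken, or it changes from 0 to 1 at a violated entry; the
  flag is then not 2, which leaves 2 free.\<close>

lemma free_color:
  "free_color x p i \<le> 2 \<and> free_color x p i \<noteq> record_color x p i \<and>
    free_color x p i \<noteq> record_color x p (Suc i) \<and> free_color x p i \<noteq> flag_color x p i"
proof -
  have "\<exists>c :: nat. c \<le> 2 \<and> c \<noteq> record_color x p i \<and> c \<noteq> record_color x p (Suc i) \<and> c \<noteq> flag_color x p i"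
  proof (cases "record_color x p i = record_color x p (Suc i)")
    case True
    have "\<exists>c :: nat. c \<le> 2 \<and> c \<noteq> a \<and> c \<noteq> b" for a b
      by (cases "a = 0 \<or> b = 0"; cases "a = 1 \<or> b = 1") (auto intro: exI[of _ 0] exI[of _ 1] exI[of _ 2])
    with True show ?thesis by simp
  next
    case False
    then have "record_color x p i = 0" "record_color x p (Suc i) = 1" "\<not> satisfied x p i"
      by (auto simp: record_color_def less_Suc_eq split: if_splits)
    then show ?thesis
      by (intro exI[of _ 2]) (auto simp: flag_color_def other_color_def)
  qed
  then show ?thesis
    unfolding free_color_def by (rule someI_ex)
qed

text \<open>A violated entry is what lets the record arrive at 1 at the end of the pattern.\<close>

lemma extended_color_allowed:
  assumes "v \<in> set (gadget p)" "\<exists>(s, a) \<in> set p. x s \<noteq> a"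
  shows "allowed v (extended_color x v)"
proof -
  obtain k i where v: "v = (k, p, i)" and k: "2 \<le> k" "k \<le> 5" "i \<le> length p"
    using assms(1) by (auto simp: set_gadget)
  have "\<exists>j < length p. \<not> satisfied x p j"
  proof -
    obtain e where "e \<in> set p" "x (fst e) \<noteq> snd e"
      using assms(2) by auto
    then obtain j where "j < length p" "p ! j = e" "x (fst e) \<noteq> snd e"
      by (auto simp: in_set_conv_nth)
    then show ?thesis
      by (auto simp: satisfied_def entry_def nth_default_nth)
  qed
  then have "record_color x p (length p) = 1"
    by (simp add: record_color_def)
  moreover have "record_color x p 0 = 0" "record_color x p i = 0 \<or> record_color x p i = 1"
    by (auto simp: record_color_def)
  moreover have "k = 2 \<or> k = 3 \<or> k = 4 \<or> k = 5"
    using k by auto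
  moreover have "free_color x p i = 0 \<or> free_color x p i = 1 \<or> free_color x p i = 2"
    using free_color[of x p i] by linarith
  ultimately show ?thesis
    unfolding v by (auto simp: allowed_def extended_color_def flag_color_def)
qed

lemma other_color: "other_color a \<noteq> a" "other_color a \<le> 1"
  by (auto simp: other_color_def)

lemma extended_color_proper:
  assumes arc: "arc u v" and V: "u \<in> set (vertices q t m ps)" "v \<in> set (vertices q t m ps)"
    and sat: "\<And>p. p \<in> set ps \<Longrightarrow> \<exists>(s, a) \<in> set p. x s \<noteq> a"
  shows "extended_color x u \<noteq> extended_color x v"
proof -
  obtain k p i l r j where uv: "u = (k, p, i)" "v = (l, r, j)"
    by (cases u, cases v) auto
  consider "k = 0" "l = 0" "i \<noteq> j" | "k \<noteq> 0" "k \<noteq> 1" "l = 0" "\<not> allowed u j"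
    | "k = 3" "l = 1" "fst (entry p i) = fst (entry r 0)"
    | "k = 3" "l = 4" "p = r" "i = j" | "k = 5" "l = 4" "p = r" "i = j"
    | "k = 5" "l = 2" "p = r" "j = i \<or> j = Suc i"
    using arc unfolding arc_def uv by auto
  then show ?thesis
  proof cases
    case 1
    then show ?thesis
      by (simp add: uv extended_color_def)
  next
    case 2
    have "u \<in> set (gadget p)" "p \<in> set ps"
      using V(1) 2 by (auto simp: uv set_vertices set_gadget)
    then have "allowed u (extended_color x u)"
      using extended_color_allowed sat by blast
    then show ?thesis
      using 2 by (auto simp: uv extended_color_def)
  next
    case 3
    then show ?thesis
      using other_color by (auto simp: uv extended_color_def satisfied_def)
  next
    case 4
    then show ?thesis
      using other_color(1)[of "snd (entry p i)"] other_color(2)[of "snd (entry p i)"]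
      by (auto simp: uv extended_color_def flag_color_def)
  next
    case 5
    then show ?thesis
      using free_color[of x p i] by (auto simp: uv extended_color_def)
  next
    case 6
    then show ?thesis
      using free_color[of x p i] by (auto simp: uv extended_color_def)
  qed
qed

lemma gadget_graph_colorable_iff:
  assumes "3 \<le> q" "distinct ps"
    and ps: "\<And>p s a. p \<in> set ps \<Longrightarrow> (s, a) \<in> set p \<Longrightarrow> s \<in> {..<m} \<times> {..<t} \<and> a < q"
  shows "colorable q {..<length (vertices q t m ps)} (index_edges adjacent (vertices q t m ps)) \<longleftrightarrow>
    (\<exists>x. (\<forall>s \<in> {..<m} \<times> {..<t}. x s < q) \<and> (\<forall>p \<in> set ps. \<exists>(s, a) \<in> set p. x s \<noteq> a))"
  unfolding colorable_index_iff[OF distinct_vertices[OF assms(2)]]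
proof
  let ?V = "set (vertices q t m ps)"
  assume "\<exists>f. (\<forall>v \<in> ?V. f v \<in> {1..q}) \<and> (\<forall>u \<in> ?V. \<forall>v \<in> ?V. adjacent u v \<longrightarrow> f u \<noteq> f v)"
  then obtain f where f: "\<And>v. v \<in> ?V \<Longrightarrow> f v \<in> {1..q}"
    "\<And>u v. u \<in> ?V \<Longrightarrow> v \<in> ?V \<Longrightarrow> adjacent u v \<Longrightarrow> f u \<noteq> f v"
    by blast
  define pal where "pal c = f (0, [], c)" for c
  have palV: "(0, [], c) \<in> ?V" if "c < q" for c
    using that by (auto simp: set_vertices)
  have "inj_on pal {..<q}"
  proof (rule inj_onI, rule ccontr)
    fix c d assume "c \<in> {..<q}" "d \<in> {..<q}" "pal c = pal d" "c \<noteq> d"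
    then show False
      using f(2)[OF palV[of c] palV[of d]] by (simp add: pal_def adjacent_def arc_def)
  qed
  moreover have "pal ` {..<q} \<subseteq> {1..q}"
    using f(1) palV by (auto simp: pal_def)
  \<comment> \<open>The palette is a clique of \<open>q\<close> vertices, so it uses every color
    exactly once.\<close>
  ultimately have bij: "pal ` {..<q} = {1..q}"
    by (intro card_subset_eq) (auto simp: card_image)
  \<comment> \<open>Renames colors by the palette: palette vertex \<open>c\<close> now has color
    \<open>c\<close>, and the edges to the palette become the lists \<open>allowed\<close>.\<close>
  define \<chi> where "\<chi> v = inv_into {..<q} pal (f v)" for v
  have \<chi>: "\<chi> v < q" "pal (\<chi> v) = f v" if "v \<in> ?V" for v
    using f(1)[OF that] inv_into_into[of "f v" pal "{..<q}"] f_inv_into_f[of "f v" pal "{..<q}"]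
    unfolding \<chi>_def bij by auto
  have proper: "\<chi> u \<noteq> \<chi> v" if "u \<in> ?V" "v \<in> ?V" "adjacent u v" for u v
    using f(2)[OF that] \<chi>(2)[OF that(1)] \<chi>(2)[OF that(2)] by auto
  have allowed: "allowed v (\<chi> v)" if "v \<in> set (gadget p)" "p \<in> set ps" for v p
  proof (rule ccontr)
    assume "\<not> allowed v (\<chi> v)"
    have v: "v \<in> ?V"
      using that by (auto simp: set_vertices)
    have "adjacent v (0, [], \<chi> v)"
      using that \<open>\<not> allowed v (\<chi> v)\<close> by (auto simp: adjacent_def arc_def set_gadget)
    then have "f v \<noteq> pal (\<chi> v)"
      unfolding pal_def by (intro f(2) v palV \<chi>)
    then show False
      using \<chi>(2)[OF v] by simp
  qed
  define x where "x s = \<chi> (1, [(s, 0)], 0)" for s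
  have "\<forall>s \<in> {..<m} \<times> {..<t}. x s < q"
    unfolding x_def by (intro ballI \<chi>(1)) (auto simp: set_vertices)
  moreover have "\<forall>p \<in> set ps. \<exists>(s, a) \<in> set p. x s \<noteq> a"
    unfolding x_def
  proof
    fix p assume p: "p \<in> set ps"
    show "\<exists>(s, a) \<in> set p. \<chi> (1, [(s, 0)], 0) \<noteq> a"
    proof (rule gadget_sound[where V = ?V])
      show "set (gadget p) \<subseteq> ?V"
        using p by (auto simp: set_vertices)
      show "(1, [(s, 0)], 0) \<in> ?V" if "(s, a) \<in> set p" for s a
        using ps[OF p that] by (auto simp: set_vertices)
    qed (use p proper allowed in auto)
  qed
  ultimately show "\<exists>x. (\<forall>s \<in> {..<m} \<times> {..<t}. x s < q) \<and> (\<forall>p \<in> set ps. \<exists>(s, a) \<in> set p. x s \<noteq> a)"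
    by blast
next
  let ?V = "set (vertices q t m ps)"
  assume "\<exists>x. (\<forall>s \<in> {..<m} \<times> {..<t}. x s < q) \<and> (\<forall>p \<in> set ps. \<exists>(s, a) \<in> set p. x s \<noteq> a)"
  then obtain x where "(\<forall>s \<in> {..<m} \<times> {..<t}. x s < q) \<and> (\<forall>p \<in> set ps. \<exists>(s, a) \<in> set p. x s \<noteq> a)"
    by (rule exE)
  note x = bspec[OF conjunct1[OF this]] bspec[OF conjunct2[OF this]]
  have less: "extended_color x v < q" if vV: "v \<in> ?V" for v
  proof -
    consider c where "v = (0, [], c)" "c < q" | j i where "v = (1, [((j, i), 0)], 0)" "j < m" "i < t"
      | p where "p \<in> set ps" "v \<in> set (gadget p)"
      using vV by (auto simp: set_vertices)
    then show ?thesis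
    proof cases
      case 3
      then obtain k i where v: "v = (k, p, i)" and i: "k = 2 \<or> i < length p"
        by (auto simp: set_gadget)
      have "snd (entry p i) < q" if "k \<noteq> 2"
        using ps[OF 3(1), of "fst (entry p i)" "snd (entry p i)"] that i by (simp add: entry_def nth_default_nth)
      moreover have "allowed v (extended_color x v)"
        using extended_color_allowed[OF 3(2) x(2)[OF 3(1)]] .
      ultimately show ?thesis
        \<comment> \<open>This is where \<open>q\<close> must be at least 3: the gadgets use the
          colors 0, 1 and 2.\<close>
        using assms(1) other_color(2)[of "snd (entry p i)"] by (auto simp: allowed_def v)
    qed (use x(1) in \<open>auto simp: extended_color_def entry_def nth_default_def\<close>)
  qed
  have proper: "extended_color x u \<noteq> extended_color x v" if "u \<in> ?V" "v \<in> ?V" "adjacent u v" for u v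
    using that(3) extended_color_proper[OF _ that(1,2) x(2)] extended_color_proper[OF _ that(2,1) x(2)]
    unfolding adjacent_def by (elim disjE) (simp, simp add: eq_commute)
  show "\<exists>f. (\<forall>v \<in> ?V. f v \<in> {1..q}) \<and> (\<forall>u \<in> ?V. \<forall>v \<in> ?V. adjacent u v \<longrightarrow> f u \<noteq> f v)"
    by (rule exI[of _ "\<lambda>v. Suc (extended_color x v)"]) (use less proper in \<open>auto simp: Suc_le_eq\<close>)
qed


subsection \<open>Clauses as forbidden patterns\<close>

text \<open>The Boolean variables are grouped into blocks of \<open>g\<close>, and a block is represented by \<open>t\<close> hub
  vertices. Every coloring of the latter is decoded by \<open>dec\<close>, which need not be injective.\<close>

locale block_code =
  fixes q t g :: nat and dec :: "nat list \<Rightarrow> nat \<Rightarrow> bool"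
  assumes q: "3 \<le> q" and g: "0 < g"
    and dec_surj: "\<And>\<beta>. \<exists>w. length w = t \<and> set w \<subseteq> {..<q} \<and> (\<forall>j < g. dec w j = \<beta> j)"
begin

text \<open>The table does not depend on the formula, so it enters the program as a constant. In
  this way an arbitrary function \<open>dec\<close>, obtained by choice, can be used by an
  algorithm.\<close>

definition table :: "bool \<Rightarrow> (nat \<times> nat) list list list" where
  "table b = map (\<lambda>j. map (zip [0..<t]) (filter (\<lambda>w. dec w j \<noteq> b) (List.n_lists t [0..<q]))) [0..<g]"

text \<open>The \<open>if\<close> selects between two constant tables, so that
  \<open>ptime_const\<close> applies to each of them.\<close>

definition literal_patterns :: "nat \<times> bool \<Rightarrow> pattern list" where
  "literal_patterns l = map (\<lambda>r. map (\<lambda>e. ((fst l div g, fst e), snd e)) r)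
     (nth_default [] (if snd l then table True else table False) (fst l mod g))"

text \<open>A clause fails iff all its literals fail, hence the concatenations. Recursion on the
  bound \<open>k\<close> keeps the construction polynomial on every input, including overlong
  clauses. Literals of one block may yield contradictory entries; no coloring matches such a
  pattern.\<close>

primrec clause_patterns :: "nat \<Rightarrow> (nat \<times> bool) list \<Rightarrow> pattern list" where
  "clause_patterns 0 C = [[]]"
| "clause_patterns (Suc k) C = (case C of [] \<Rightarrow> [[]] | l # ls \<Rightarrow>
     concat (map (\<lambda>p. map (\<lambda>p'. p @ p') (clause_patterns k ls)) (literal_patterns l)))"

text \<open>Gadget vertices are named by their pattern, so a pattern shared by several clauses must
  occur only once.\<close>

definition patterns :: "nat \<Rightarrow> cnf \<Rightarrow> pattern list" where
  "patterns k \<phi> = fold List.insert (concat (map (clause_patterns k) \<phi>)) []"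

definition word :: "(site \<Rightarrow> nat) \<Rightarrow> nat \<Rightarrow> nat list" where
  "word x j = map (\<lambda>i. x (j, i)) [0..<t]"

lemma literal_patterns_eq:
  "literal_patterns (y, b) = map (\<lambda>w. map (\<lambda>e. ((y div g, fst e), snd e)) (zip [0..<t] w))
     (filter (\<lambda>w. dec w (y mod g) \<noteq> b) (List.n_lists t [0..<q]))"
proof -
  have "y mod g < g"
    using g by simp
  then have "nth_default [] (table b) (y mod g) =
      map (zip [0..<t]) (filter (\<lambda>w. dec w (y mod g) \<noteq> b) (List.n_lists t [0..<q]))"
    by (simp add: nth_default_nth table_def)
  then show ?thesis
    unfolding literal_patterns_def by (cases b) (auto simp: comp_def)
qed

text \<open>A coloring matches the pattern of exactly one word, the one it spells on the block; the
  literal fails iff that word is listed for it.\<close>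

lemma literal_patterns_sat:
  assumes "\<And>i. i < t \<Longrightarrow> x (y div g, i) < q"
  shows "(\<exists>p \<in> set (literal_patterns (y, b)). \<forall>(s, a) \<in> set p. x s = a) \<longleftrightarrow>
    dec (word x (y div g)) (y mod g) \<noteq> b"
proof -
  have word: "word x (y div g) \<in> set (List.n_lists t [0..<q])"
    using assms by (auto simp: set_n_lists word_def)
  have "(\<forall>(s, a) \<in> set (map (\<lambda>e. ((y div g, fst e), snd e)) (zip [0..<t] w)). x s = a) \<longleftrightarrow> w = word x (y div g)"
    if "w \<in> set (List.n_lists t [0..<q])" for w
  proof -
    have len: "length w = t"
      using that by (simp add: set_n_lists)
    have "(\<forall>(s, a) \<in> set (map (\<lambda>e. ((y div g, fst e), snd e)) (zip [0..<t] w)). x s = a) \<longleftrightarrow>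
        (\<forall>i < t. x (y div g, i) = w ! i)"
    proof -
      have "set (zip [0..<t] w) = (\<lambda>i. (i, w ! i)) ` {..<t}"
        using len by (force simp: set_zip)
      then show ?thesis by auto
    qed
    also have "\<dots> \<longleftrightarrow> w = word x (y div g)"
      using len by (auto simp: word_def list_eq_iff_nth_eq)
    finally show ?thesis .
  qed
  then show ?thesis
    unfolding literal_patterns_eq using word by auto
qed

lemma literal_patterns_sites:
  assumes "p \<in> set (literal_patterns (y, b))"
  shows "length p = t" "(s, a) \<in> set p \<Longrightarrow> fst s = y div g \<and> snd s < t \<and> a < q"
proof -
  obtain w where w: "length w = t" "set w \<subseteq> {..<q}" "p = map (\<lambda>e. ((y div g, fst e), snd e)) (zip [0..<t] w)"
  proof -
    from assms obtain w where "w \<in> set (List.n_lists t [0..<q])"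
      "p = map (\<lambda>e. ((y div g, fst e), snd e)) (zip [0..<t] w)"
      unfolding literal_patterns_eq by auto
    then show ?thesis
      using that[of w] by (auto simp: set_n_lists atLeast0LessThan)
  qed
  show "length p = t"
    using w by simp
  show "fst s = y div g \<and> snd s < t \<and> a < q" if "(s, a) \<in> set p"
    using that w by (auto dest: set_zip_leftD set_zip_rightD)
qed

lemma clause_patterns_sat:
  assumes "length C \<le> k" "\<And>y b i. (y, b) \<in> set C \<Longrightarrow> i < t \<Longrightarrow> x (y div g, i) < q"
  shows "(\<exists>p \<in> set (clause_patterns k C). \<forall>(s, a) \<in> set p. x s = a) \<longleftrightarrow>
    (\<forall>(y, b) \<in> set C. dec (word x (y div g)) (y mod g) \<noteq> b)"
  using assms
proof (induction k arbitrary: C)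
  case (Suc k)
  show ?case
  proof (cases C)
    case (Cons l ls)
    obtain y b where l: "l = (y, b)"
      by (cases l)
    have "(\<exists>p \<in> set (clause_patterns (Suc k) C). \<forall>(s, a) \<in> set p. x s = a) \<longleftrightarrow>
      (\<exists>p \<in> set (literal_patterns l). \<forall>(s, a) \<in> set p. x s = a) \<and>
      (\<exists>p \<in> set (clause_patterns k ls). \<forall>(s, a) \<in> set p. x s = a)"
      unfolding Cons by (simp add: ball_Un)
    also have "(\<exists>p \<in> set (clause_patterns k ls). \<forall>(s, a) \<in> set p. x s = a) \<longleftrightarrow>
      (\<forall>(y, b) \<in> set ls. dec (word x (y div g)) (y mod g) \<noteq> b)"
      using Suc.prems by (intro Suc.IH) (auto simp: Cons)
    also have "(\<exists>p \<in> set (literal_patterns l). \<forall>(s, a) \<in> set p. x s = a) \<longleftrightarrow>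
      dec (word x (y div g)) (y mod g) \<noteq> b"
      unfolding l using Suc.prems(2)[of y b] by (intro literal_patterns_sat) (auto simp: Cons l)
    finally show ?thesis
      by (simp add: Cons l)
  qed simp
qed simp

lemma length_clause_patterns: "p \<in> set (clause_patterns k C) \<Longrightarrow> length p \<le> k * t"
proof (induction k arbitrary: C p)
  case (Suc k)
  show ?case
  proof (cases C)
    case (Cons l ls)
    then obtain p1 p2 where p: "p1 \<in> set (literal_patterns (fst l, snd l))" "p2 \<in> set (clause_patterns k ls)" "p = p1 @ p2"
      using Suc.prems by auto
    then show ?thesis
      using Suc.IH[OF p(2)] literal_patterns_sites(1)[OF p(1)] by simp
  qed (use Suc.prems in simp)
qed simp

lemma clause_patterns_sites:
  "p \<in> set (clause_patterns k C) \<Longrightarrow> (s, a) \<in> set p \<Longrightarrow>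
    (\<exists>(y, b) \<in> set C. fst s = y div g) \<and> snd s < t \<and> a < q"
proof (induction k arbitrary: C p)
  case (Suc k)
  show ?case
  proof (cases C)
    case (Cons l ls)
    then obtain p1 p2 where p: "p1 \<in> set (literal_patterns (fst l, snd l))" "p2 \<in> set (clause_patterns k ls)" "p = p1 @ p2"
      using Suc.prems by auto
    show ?thesis
    proof (cases "(s, a) \<in> set p1")
      case True
      then show ?thesis
        using literal_patterns_sites(2)[OF p(1) True] Cons by (cases l) auto
    next
      case False
      then have "(s, a) \<in> set p2"
        using p Suc.prems by auto
      from Suc.IH[OF p(2) this] show ?thesis
        using Cons by auto
    qed
  qed (use Suc.prems in simp)
qed simp

lemma distinct_patterns: "distinct (patterns k \<phi>)"
proof -
  have "distinct ys \<Longrightarrow> distinct (fold List.insert xs ys)" for xs ys :: "pattern list"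
    by (induction xs arbitrary: ys) auto
  then show ?thesis
    by (simp add: patterns_def)
qed

lemma set_patterns: "set (patterns k \<phi>) = (\<Union>C \<in> set \<phi>. set (clause_patterns k C))"
proof -
  have "set (fold List.insert xs ys) = set xs \<union> set ys" for xs ys :: "pattern list"
    by (induction xs arbitrary: ys) auto
  then show ?thesis
    by (simp add: patterns_def)
qed

text \<open>A coloring is decoded block by block, and conversely \<open>dec_surj\<close> supplies a
  word for the bits of each block. \<open>Suc (n div g)\<close> blocks cover all variables, also if
  \<open>g\<close> does not divide \<open>n\<close>.\<close>

lemma patterns_sat_iff:
  assumes "ksat_instance k n \<phi>"
  shows "(\<exists>x. (\<forall>s \<in> {..<Suc (n div g)} \<times> {..<t}. x s < q) \<and> (\<forall>p \<in> set (patterns k \<phi>). \<exists>(s, a) \<in> set p. x s \<noteq> a))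
    \<longleftrightarrow> cnf_satisfiable \<phi>"
proof -
  have inst: "length C \<le> k" "y < n" if "C \<in> set \<phi>" "(y, b) \<in> set C" for C y b
    using assms that by (auto simp: ksat_instance_def)
  have inst0: "length C \<le> k" if "C \<in> set \<phi>" for C
    using assms that by (auto simp: ksat_instance_def)
  have sat: "(\<forall>p \<in> set (patterns k \<phi>). \<exists>(s, a) \<in> set p. x s \<noteq> a) \<longleftrightarrow>
    (\<forall>C \<in> set \<phi>. \<exists>(y, b) \<in> set C. dec (word x (y div g)) (y mod g) = b)"
    if x: "\<forall>s \<in> {..<Suc (n div g)} \<times> {..<t}. x s < q" for x
  proof -
    have "(\<forall>p \<in> set (clause_patterns k C). \<exists>(s, a) \<in> set p. x s \<noteq> a) \<longleftrightarrow>
      (\<exists>(y, b) \<in> set C. dec (word x (y div g)) (y mod g) = b)" if C: "C \<in> set \<phi>" for C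
    proof -
      have "x (y div g, i) < q" if "(y, b) \<in> set C" "i < t" for y b i
      proof -
        have "y div g \<le> n div g"
          using inst(2)[OF C that(1)] by (intro div_le_mono) simp
        then show ?thesis
          using x that(2) by auto
      qed
      from clause_patterns_sat[of C k x, OF inst0[OF C] this]
      have "\<not> (\<exists>p \<in> set (clause_patterns k C). \<forall>(s, a) \<in> set p. x s = a) \<longleftrightarrow>
        \<not> (\<forall>(y, b) \<in> set C. dec (word x (y div g)) (y mod g) \<noteq> b)"
        by simp
      then show ?thesis
        by (simp add: case_prod_beta)
    qed
    then show ?thesis
      by (simp add: set_patterns)
  qed
  show ?thesis
  proof
    assume "\<exists>x. (\<forall>s \<in> {..<Suc (n div g)} \<times> {..<t}. x s < q) \<and> (\<forall>p \<in> set (patterns k \<phi>). \<exists>(s, a) \<in> set p. x s \<noteq> a)"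
    then obtain x where "(\<forall>s \<in> {..<Suc (n div g)} \<times> {..<t}. x s < q) \<and> (\<forall>p \<in> set (patterns k \<phi>). \<exists>(s, a) \<in> set p. x s \<noteq> a)"
      by (rule exE)
    then have "\<forall>C \<in> set \<phi>. \<exists>(y, b) \<in> set C. dec (word x (y div g)) (y mod g) = b"
      using sat[of x] by simp
    then show "cnf_satisfiable \<phi>"
      unfolding cnf_satisfiable_def by (intro exI[of _ "\<lambda>y. dec (word x (y div g)) (y mod g)"])
  next
    assume "cnf_satisfiable \<phi>"
    then obtain a where a: "\<forall>C \<in> set \<phi>. \<exists>(y, b) \<in> set C. a y = b"
      unfolding cnf_satisfiable_def by (rule exE)
    define w where "w j = (SOME w. length w = t \<and> set w \<subseteq> {..<q} \<and> (\<forall>i < g. dec w i = a (j * g + i)))" for j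
    have w: "length (w j) = t \<and> set (w j) \<subseteq> {..<q} \<and> (\<forall>i < g. dec (w j) i = a (j * g + i))" for j
      unfolding w_def by (rule someI_ex) (rule dec_surj)
    define x where "x s = w (fst s) ! snd s" for s
    have word: "word x j = w j" for j
      using w[of j] by (auto simp: word_def x_def list_eq_iff_nth_eq)
    have x: "\<forall>s \<in> {..<Suc (n div g)} \<times> {..<t}. x s < q"
    proof
      fix s assume "s \<in> {..<Suc (n div g)} \<times> {..<t}"
      then have "w (fst s) ! snd s \<in> set (w (fst s))"
        using w[of "fst s"] by (intro nth_mem) auto
      then show "x s < q"
        using w[of "fst s"] by (auto simp: x_def)
    qed
    have "dec (word x (y div g)) (y mod g) = a y" for y
      using w[of "y div g"] g by (simp add: word)
    then have "\<forall>C \<in> set \<phi>. \<exists>(y, b) \<in> set C. dec (word x (y div g)) (y mod g) = b"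
      using a by simp
    then show "\<exists>x. (\<forall>s \<in> {..<Suc (n div g)} \<times> {..<t}. x s < q) \<and> (\<forall>p \<in> set (patterns k \<phi>). \<exists>(s, a) \<in> set p. x s \<noteq> a)"
      using x sat[OF x] by (intro exI[of _ x]) simp
  qed
qed

definition instance_vertices :: "nat \<Rightarrow> nat \<times> cnf \<Rightarrow> vertex list" where
  "instance_vertices k x = vertices q t (Suc (fst x div g)) (patterns k (snd x))"

definition reduction :: "nat \<Rightarrow> nat \<times> cnf \<Rightarrow> bool list list \<times> bool list" where
  "reduction k x = (map (\<lambda>u. map (\<lambda>v. adjacent u v) (instance_vertices k x)) (instance_vertices k x),
     map in_hub (instance_vertices k x))"

lemma reduction_correct:
  assumes "ksat_instance k n \<phi>"
  defines "vs \<equiv> instance_vertices k (n, \<phi>)"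
  shows "simple_graph {..<length vs} (index_edges adjacent vs)"
    and "is_hub (4 * (k * t) + 1) (q + k * t) {..<length vs} (index_edges adjacent vs) (index_set in_hub vs)"
    and "card (index_set in_hub vs) = q + Suc (n div g) * t"
    and "colorable q {..<length vs} (index_edges adjacent vs) \<longleftrightarrow> cnf_satisfiable \<phi>"
    and "enc_graph_hub (length vs) (index_edges adjacent vs) (index_set in_hub vs) = repr (reduction k (n, \<phi>))"
proof -
  have vs: "vs = vertices q t (Suc (n div g)) (patterns k \<phi>)"
    by (simp add: vs_def instance_vertices_def)
  show "simple_graph {..<length vs} (index_edges adjacent vs)"
    by (rule simple_graph_index[OF adjacent_sym adjacent_irrefl])
  show "is_hub (4 * (k * t) + 1) (q + k * t) {..<length vs} (index_edges adjacent vs) (index_set in_hub vs)"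
    unfolding vs
    by (intro is_hub_vertices distinct_patterns) (auto simp: set_patterns dest: length_clause_patterns)
  show "card (index_set in_hub vs) = q + Suc (n div g) * t"
    unfolding vs by (simp only: card_index_set card_hub)
  show "colorable q {..<length vs} (index_edges adjacent vs) \<longleftrightarrow> cnf_satisfiable \<phi>"
    unfolding vs patterns_sat_iff[OF assms(1), symmetric]
  proof (rule gadget_graph_colorable_iff[OF q distinct_patterns])
    fix p s a assume "p \<in> set (patterns k \<phi>)" and sa: "(s, a) \<in> set p"
    then obtain C where C: "C \<in> set \<phi>" "p \<in> set (clause_patterns k C)"
      by (auto simp: set_patterns)
    obtain y b where yb: "(y, b) \<in> set C" "fst s = y div g" "snd s < t" "a < q"
      using clause_patterns_sites[OF C(2) sa] by auto
    have "y < n"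
      using assms(1) C yb(1) by (auto simp: ksat_instance_def)
    then have "y div g \<le> n div g"
      by (intro div_le_mono) simp
    then show "s \<in> {..<Suc (n div g)} \<times> {..<t} \<and> a < q"
      using yb by (cases s) auto
  qed
  show "enc_graph_hub (length vs) (index_edges adjacent vs) (index_set in_hub vs) = repr (reduction k (n, \<phi>))"
    unfolding enc_graph_hub_index by (simp add: reduction_def vs_def)
qed

end

subsection \<open>The reduction runs in polynomial time\<close>

text \<open>For a constant divisor, a counter that wraps at \<open>g\<close> and increments the
  quotient at each wrap does the division.\<close>

lemma ptime_divmod:
  fixes g :: nat
  assumes "0 < g" "ptime f"
  shows "ptime (\<lambda>x. (f x div g, f x mod g))"
proof -
  let ?step = "\<lambda>s :: nat \<times> nat. if Suc (snd s) = g then (Suc (fst s), 0) else (fst s, Suc (snd s))"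
  have "ptime (\<lambda>x. fold (\<lambda>_. ?step) (replicate (f x) Nl) (0, 0))"
  proof (rule ptime_fold[OF _ _ _ pbounded_const[of 1]])
    show "sz (?step s) \<le> sz s + 1" for s
      by (cases s) auto
  qed (intro ptime_intros assms)+
  moreover have "(?step ^^ n) (0, 0) = (n div g, n mod g)" for n
    using assms(1) by (induction n) (auto simp: div_Suc mod_Suc)
  ultimately show ?thesis by simp
qed

lemma ptime_div: "0 < (g :: nat) \<Longrightarrow> ptime f \<Longrightarrow> ptime (\<lambda>x. f x div g)"
  using ptime_fst[OF ptime_divmod] by simp

lemma ptime_mod: "0 < (g :: nat) \<Longrightarrow> ptime f \<Longrightarrow> ptime (\<lambda>x. f x mod g)"
  using ptime_snd[OF ptime_divmod] by simp

lemma ptime_pattern_eq: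
  fixes f f' :: "'a :: repr \<Rightarrow> pattern"
  assumes "ptime f" "ptime f'"
  shows "ptime (\<lambda>x. f x = f' x)"
  using assms by (intro ptime_list_eq) (intro ptime_intros)+

lemma ptime_insert:
  fixes f :: "'a :: repr \<Rightarrow> pattern"
  assumes "ptime f" "ptime l"
  shows "ptime (\<lambda>x. List.insert (f x) (l x))"
proof -
  have "List.insert p ps = (if \<exists>r \<in> set ps. p = r then ps else p # ps)" for p and ps :: "pattern list"
    by (auto simp: List.insert_def)
  then show ?thesis
    by (simp only:) (intro ptime_intros ptime_pattern_eq ptime_comp[OF assms(1)] ptime_comp[OF assms(2)])
qed

lemma ptime_other_color: "ptime f \<Longrightarrow> ptime (\<lambda>x. other_color (f x))"
  unfolding other_color_def by (intro ptime_intros)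

lemma ptime_entry: "ptime f \<Longrightarrow> ptime g \<Longrightarrow> ptime (\<lambda>x. entry (f x) (g x))"
  unfolding entry_def by (intro ptime_intros)

lemma ptime_allowed: "ptime f \<Longrightarrow> ptime g \<Longrightarrow> ptime (\<lambda>x. allowed (f x) (g x))"
  unfolding allowed_def by (intro ptime_intros ptime_other_color ptime_entry)

lemma ptime_arc: "ptime f \<Longrightarrow> ptime g \<Longrightarrow> ptime (\<lambda>x. arc (f x) (g x))"
  unfolding arc_def by (intro ptime_intros ptime_entry ptime_allowed ptime_pattern_eq)

lemma ptime_adjacent: "ptime f \<Longrightarrow> ptime g \<Longrightarrow> ptime (\<lambda>x. adjacent (f x) (g x))"
  unfolding adjacent_def by (intro ptime_intros ptime_arc)

lemma ptime_in_hub: "ptime f \<Longrightarrow> ptime (\<lambda>x. in_hub (f x))"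
  unfolding in_hub_def by (intro ptime_intros)

lemma ptime_gadget: "ptime f \<Longrightarrow> ptime (\<lambda>x. gadget (f x))"
  by (rule ptime_comp[of gadget]) (unfold gadget_def[abs_def], intro ptime_intros)

lemma ptime_vertices:
  assumes "ptime f" "ptime h"
  shows "ptime (\<lambda>x. vertices q t (f x) (h x))"
  unfolding vertices_def by (intro ptime_intros ptime_gadget assms)

context block_code
begin

lemma ptime_literal_patterns: "ptime f \<Longrightarrow> ptime (\<lambda>x. literal_patterns (f x))"
  by (rule ptime_comp[of literal_patterns])
    (unfold literal_patterns_def[abs_def], intro ptime_intros ptime_div[OF g] ptime_mod[OF g])

lemma ptime_clause_patterns: "ptime (clause_patterns k)"
proof (induction k)
  case 0
  show ?case by (simp add: ptime_const)
next
  case (Suc k)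
  show ?case
    by (simp only: clause_patterns.simps) (intro ptime_intros ptime_literal_patterns ptime_comp[OF Suc.IH])
qed

lemma ptime_patterns: "ptime (patterns k)"
proof -
  have "ptime (\<lambda>\<phi>. fold List.insert (concat (map (clause_patterns k) \<phi>)) [])"
  proof (rule ptime_fold)
    show "pbounded (\<lambda>x :: cnf \<times> pattern. sz x + 1)"
      by (intro pbounded_add pbounded_sz pbounded_const)
    show "sz (List.insert p s) \<le> sz s + (sz (x, p) + 1)" for x :: cnf and p :: pattern and s
      by (auto simp: List.insert_def)
  qed (intro ptime_intros ptime_insert ptime_comp[OF ptime_clause_patterns])+
  then show ?thesis
    by (simp add: patterns_def[abs_def])
qed

lemma ptime_reduction: "ptime (reduction k)"
proof -
  have vs: "ptime (instance_vertices k)"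
    unfolding instance_vertices_def[abs_def]
    by (intro ptime_vertices ptime_intros ptime_div[OF g] ptime_comp[OF ptime_patterns])
  show ?thesis
    unfolding reduction_def[abs_def]
    by (intro ptime_intros ptime_adjacent ptime_in_hub ptime_comp[OF vs])
qed

end


subsection \<open>Parameters and running time\<close>

lemma ex_decoder:
  assumes "2 ^ g \<le> q ^ t"
  shows "\<exists>dec :: nat list \<Rightarrow> nat \<Rightarrow> bool. \<forall>\<beta>. \<exists>w. length w = t \<and> set w \<subseteq> {..<q} \<and> (\<forall>j < g. dec w j = \<beta> j)"
proof -
  let ?W = "{w. set w \<subseteq> {..<q} \<and> length w = t}"
  have "finite ?W" "card ?W = q ^ t"
    using finite_lists_length_eq[of "{..<q}" t] card_lists_length_eq[of "{..<q}" t] by auto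
  moreover have "card (Pow {..<g}) = 2 ^ g"
    by (simp add: card_Pow)
  ultimately obtain h where h: "h ` Pow {..<g} \<subseteq> ?W" "inj_on h (Pow {..<g})"
    using card_le_inj[of "Pow {..<g}" ?W] assms by auto
  define dec where "dec w j \<longleftrightarrow> j \<in> inv_into (Pow {..<g}) h w" for w j
  have "\<exists>w. length w = t \<and> set w \<subseteq> {..<q} \<and> (\<forall>j < g. dec w j = \<beta> j)" for \<beta>
  proof -
    let ?J = "{j. j < g \<and> \<beta> j}"
    have J: "?J \<in> Pow {..<g}"
      by auto
    then have "h ?J \<in> ?W"
      using h(1) by blast
    moreover have "\<forall>j < g. dec (h ?J) j = \<beta> j"
      unfolding dec_def inv_into_f_f[OF h(2) J] by simp
    ultimately show ?thesis by blast
  qed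
  then show ?thesis by blast
qed

text \<open>Take \<open>t\<close> with \<open>(q / r) ^ t > 2\<close> and the largest
  \<open>g\<close> with \<open>2 ^ g \<le> q ^ t\<close>. Then
  \<open>2 * r ^ t < q ^ t < 2 * 2 ^ g\<close>, and \<open>g > 0\<close> because
  \<open>r ^ t \<ge> 1\<close>.\<close>

lemma ex_block_sizes:
  fixes r :: real
  assumes "1 \<le> r" "r < real q" "2 \<le> q"
  shows "\<exists>t g. 0 < g \<and> r ^ t < 2 ^ g \<and> (2 :: nat) ^ g \<le> q ^ t"
proof -
  have "1 < real q / r"
    using assms by (simp add: field_simps)
  then obtain t where "2 < (real q / r) ^ t"
    using real_arch_pow by blast
  then have t: "2 * r ^ t < real q ^ t"
    using assms(1) by (simp add: power_divide field_simps)
  have "1 \<le> q ^ t"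
    using assms(3) by simp
  then obtain g where g: "2 ^ g \<le> q ^ t" "q ^ t < 2 ^ (g + 1)"
    using ex_power_ivl1[of 2 "q ^ t"] by auto
  have "real q ^ t < 2 * 2 ^ g"
    using g(2) by (metis of_nat_less_iff of_nat_numeral of_nat_power power_add power_one_right mult.commute)
  then have r: "r ^ t < 2 ^ g"
    using t by linarith
  moreover have "g \<noteq> 0"
    using r one_le_power[OF assms(1), of t] by (intro notI) simp
  ultimately show ?thesis
    using g(1) by blast
qed

section \<open>Running time in terms of the number of variables\<close>

lemma enc_cnf_eq_repr: "enc_cnf n \<phi> = repr (n, \<phi>)"
proof -
  have "(\<lambda>(x, b). Pr (enc_nat x) (enc_bool b)) = repr"
    by (auto simp: repr_prod_def repr_nat_def repr_bool_def)
  then show ?thesis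
    by (simp add: enc_cnf_def repr_nat_def repr_list_def)
qed

text \<open>Distinct clauses of length at most \<open>k\<close> over \<open>2 * n\<close> literals
  number at most \<open>(k + 1) * (2 * n + 1) ^ k\<close>, and a literal has linear size since its
  variable is in unary.\<close>

lemma sz_ksat_instance:
  assumes "ksat_instance k n \<phi>"
  shows "sz (n, \<phi>) \<le> 1 + n + (k + 1) * (2 * n + 1) ^ k * (1 + k * (n + 3))"
proof -
  let ?A = "{..<n} \<times> (UNIV :: bool set)"
  have \<phi>: "set \<phi> \<subseteq> {xs. set xs \<subseteq> ?A \<and> length xs \<le> k}"
    using assms by (auto simp: ksat_instance_def)
  have fin: "finite ?A" "card ?A = 2 * n"
    by (auto simp: card_cartesian_product)
  have "length \<phi> = card (set \<phi>)"
    using assms by (simp add: ksat_instance_def distinct_card)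
  also have "\<dots> \<le> card {xs. set xs \<subseteq> ?A \<and> length xs \<le> k}"
    by (intro card_mono \<phi> finite_lists_length_le fin)
  also have "\<dots> = (\<Sum>i\<le>k. (2 * n) ^ i)"
    using card_lists_length_le[OF fin(1)] fin(2) by simp
  also have "\<dots> \<le> (\<Sum>i\<le>k. (2 * n + 1) ^ k)"
  proof (rule sum_mono)
    fix i assume "i \<in> {..k}"
    then show "(2 * n) ^ i \<le> (2 * n + 1) ^ k"
      by (intro order_trans[OF power_mono[of "2 * n" "2 * n + 1" i] power_increasing]) auto
  qed
  finally have len: "length \<phi> \<le> (k + 1) * (2 * n + 1) ^ k"
    by simp
  have clause: "sz C \<le> k * (n + 3)" if "C \<in> set \<phi>" for C
  proof -
    have "sz l \<le> n + 2" if "l \<in> set C" for l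
    proof -
      have "fst l < n"
        using assms \<open>C \<in> set \<phi>\<close> that by (cases l) (auto simp: ksat_instance_def)
      then show ?thesis
        using sz_bool_le[of "snd l"] by (simp add: sz_pair)
    qed
    then have "sz C \<le> length C * Suc (n + 2)"
      by (rule sz_list_le)
    also have "\<dots> \<le> k * (n + 3)"
      using assms that by (intro mult_le_mono) (auto simp: ksat_instance_def)
    finally show ?thesis .
  qed
  have "sz \<phi> \<le> length \<phi> * Suc (k * (n + 3))"
    by (rule sz_list_le) (rule clause)
  also have "\<dots> \<le> (k + 1) * (2 * n + 1) ^ k * (1 + k * (n + 3))"
    using len by (intro mult_le_mono) auto
  finally show ?thesis by simp
qed

text \<open>\<open>ptime\<close> bounds refer to the size of the encoding, the SETH to the number of
  variables; for fixed \<open>k\<close> this passes from one to the other.\<close>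

lemma pbounded_ksat:
  fixes h :: "nat \<times> cnf \<Rightarrow> nat"
  assumes "pbounded h"
  shows "\<exists>H. pbounded H \<and> (\<forall>n \<phi>. ksat_instance k n \<phi> \<longrightarrow> h (n, \<phi>) \<le> H n)"
proof -
  obtain c d where c: "\<And>x. h x \<le> c * (sz x + 1) ^ d"
    using assms unfolding pbounded_def by blast
  define H where "H n = c * ((1 + n + (k + 1) * (2 * n + 1) ^ k * (1 + k * (n + 3))) + 1) ^ d" for n
  have id: "pbounded (\<lambda>n :: nat. n)"
    using pbounded_sz[where 'a = nat] by (rule pbounded_mono) simp
  have "pbounded H"
    unfolding H_def by (intro pbounded_add pbounded_mult pbounded_power pbounded_const id)
  moreover have "h (n, \<phi>) \<le> H n" if "ksat_instance k n \<phi>" for n \<phi>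
    unfolding H_def using sz_ksat_instance[OF that]
    by (intro order_trans[OF c] mult_le_mono power_mono) auto
  ultimately show ?thesis by blast
qed

lemma (in block_code) ksat_from_coloring:
  fixes r :: real
  assumes r: "1 \<le> r" "r < real q"
    and alg: "\<And>n E Q p. simple_graph {..<n} E \<Longrightarrow> is_hub (4 * (k * t) + 1) (q + k * t) {..<n} E Q \<Longrightarrow> card Q \<le> p \<Longrightarrow>
      decides_within prog (enc_graph_hub n E Q) (colorable q {..<n} E) (r ^ p * (real c * real (n + 1) ^ d))"
  shows "\<exists>prog (c::nat) (d::nat). \<forall>n \<phi>. ksat_instance k n \<phi> \<longrightarrow>
    decides_within prog (enc_cnf n \<phi>) (cnf_satisfiable \<phi>) (root g (r ^ t) ^ n * (real c * real (n + 1) ^ d))"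
proof -
  \<comment> \<open>With this base, \<open>g\<close> Boolean variables cost \<open>r ^ t\<close>,
    the price of the \<open>t\<close> hub vertices that encode them.\<close>
  let ?b = "root g (r ^ t)"
  have b: "1 \<le> ?b" "?b ^ g = r ^ t"
    using r(1) g by (auto simp: real_root_ge_1_iff)
  obtain p1 T where p1: "pbounded T" "computes p1 T (reduction k)"
    using ptime_reduction[of k] by (blast elim: ptimeE)
  obtain H1 where H1: "pbounded H1" "\<And>n \<phi>. ksat_instance k n \<phi> \<Longrightarrow> T (n, \<phi>) \<le> H1 n"
    using pbounded_ksat[OF p1(1), of k] by blast
  obtain H2 where H2: "pbounded H2" "\<And>n \<phi>. ksat_instance k n \<phi> \<Longrightarrow> sz (reduction k (n, \<phi>)) \<le> H2 n"
    using pbounded_ksat[OF ptime_pbounded[OF ptime_reduction[of k]], of k] by blast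
  \<comment> \<open>Combines the time of the reduction with the polynomial part of the coloring
    time. The constant \<open>q ^ (q + t)\<close> pays for the palette and for the additional
    block.\<close>
  define H where "H n = H1 n + q ^ (q + t) * (c * (H2 n + 1) ^ d)" for n
  have "pbounded H"
    unfolding H_def by (intro pbounded_add pbounded_mult pbounded_power pbounded_const H1 H2)
  then obtain C D where CD: "\<And>n. H n \<le> C * (sz n + 1) ^ D"
    unfolding pbounded_def by blast
  have "decides_within (Seq p1 prog) (enc_cnf n \<phi>) (cnf_satisfiable \<phi>) (?b ^ n * (real C * real (n + 1) ^ D))"
    if inst: "ksat_instance k n \<phi>" for n \<phi>
  proof -
    define vs where "vs = instance_vertices k (n, \<phi>)"
    define p where "p = q + Suc (n div g) * t"
    note red = reduction_correct[OF inst, folded vs_def]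
    obtain t1 where t1: "t1 \<le> T (n, \<phi>)"
      "exec p1 (init_state (repr (n, \<phi>))) t1 (init_state (repr (reduction k (n, \<phi>))))"
      by (rule computesE[OF p1(2)])
    have "decides_within prog (repr (reduction k (n, \<phi>))) (cnf_satisfiable \<phi>)
      (r ^ p * (real c * real (length vs + 1) ^ d))"
      using alg[OF red(1,2), of p] red(3) unfolding red(4,5) p_def by simp
    then obtain t2 s where t2: "exec prog (init_state (repr (reduction k (n, \<phi>)))) t2 s"
      "s 0 = enc_bool (cnf_satisfiable \<phi>)" "real t2 \<le> r ^ p * (real c * real (length vs + 1) ^ d)"
      unfolding decides_within_def init_state_def[symmetric] by auto
    have "length vs \<le> sz (reduction k (n, \<phi>))"
      using length_le_sz[of "map in_hub vs"] by (simp add: reduction_def vs_def)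
    then have len: "length vs \<le> H2 n"
      using H2(2)[OF inst] by simp
    have "r ^ p = r ^ (q + t) * (r ^ t) ^ (n div g)"
      by (simp add: p_def power_add power_mult[symmetric] mult_ac)
    also have "\<dots> = r ^ (q + t) * ?b ^ (g * (n div g))"
      by (simp only: power_mult b(2))
    \<comment> \<open>Rounding is harmless: \<open>g * (n div g) \<le> n\<close>, and the base is at
      least 1.\<close>
    also have "\<dots> \<le> real q ^ (q + t) * ?b ^ n"
      using r b(1) by (intro mult_mono power_mono power_increasing) auto
    finally have rp: "r ^ p \<le> real q ^ (q + t) * ?b ^ n" .
    have "real t2 \<le> (real q ^ (q + t) * ?b ^ n) * (real c * real (H2 n + 1) ^ d)"
      by (rule order_trans[OF t2(3)])
        (use rp len b(1) in \<open>intro mult_mono power_mono, auto\<close>)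
    moreover have "real t1 \<le> ?b ^ n * real (H1 n)"
    proof -
      have "real t1 \<le> 1 * real (H1 n)"
        using t1(1) H1(2)[OF inst] by simp
      also have "\<dots> \<le> ?b ^ n * real (H1 n)"
        using b(1) by (intro mult_right_mono) auto
      finally show ?thesis .
    qed
    ultimately have "real (t1 + t2) \<le> ?b ^ n * real (H n)"
      by (simp add: H_def algebra_simps)
    also have "\<dots> \<le> ?b ^ n * (real C * real (n + 1) ^ D)"
    proof -
      have "real (H n) \<le> real (C * (n + 1) ^ D)"
        using CD[of n] by (intro of_nat_mono) simp
      then show ?thesis
        using b(1) by (intro mult_left_mono) auto
    qed
    finally have "real (t1 + t2) \<le> ?b ^ n * (real C * real (n + 1) ^ D)" .
    then show ?thesis
      unfolding decides_within_def init_state_def[symmetric] enc_cnf_eq_repr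
      using exec.Seq[OF t1(2) t2(1)] t2(2) by blast
  qed
  then show ?thesis by blast
qed

lemma coloring_lower_bound:
  fixes \<epsilon> :: real
  assumes "3 \<le> q" "0 < \<epsilon>" SETH
  shows "\<exists>\<sigma> \<ge> 1. \<exists>\<delta> \<ge> 1. \<not> (\<exists>prog (c::nat) (d::nat). \<forall>n E Q p.
    simple_graph {..<n} E \<and> is_hub \<sigma> \<delta> {..<n} E Q \<and> card Q \<le> p \<longrightarrow>
      decides_within prog (enc_graph_hub n E Q) (colorable q {..<n} E)
        ((real q - \<epsilon>) ^ p * (real c * real (n + 1) ^ d)))"
proof -
  \<comment> \<open>For large \<open>\<epsilon>\<close> the base may drop below 1. Raising a
    positive base to 1 only weakens the time bound, and \<open>ex_block_sizes\<close> needs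
    \<open>1 \<le> r\<close>.\<close>
  define r where "r = max 1 (real q - \<epsilon>)"
  have r: "1 \<le> r" "r < real q"
    using assms by (auto simp: r_def)
  obtain t g where tg: "0 < g" "r ^ t < 2 ^ g" "(2 :: nat) ^ g \<le> q ^ t"
    using ex_block_sizes[OF r] assms(1) by auto
  obtain dec :: "nat list \<Rightarrow> nat \<Rightarrow> bool" where "\<forall>\<beta>. \<exists>w. length w = t \<and> set w \<subseteq> {..<q} \<and> (\<forall>j < g. dec w j = \<beta> j)"
    using ex_decoder[OF tg(3)] by (rule exE)
  then interpret block_code q t g dec
    by unfold_locales (use assms(1) tg(1) in auto)
  have root: "root g (r ^ t) < 2"
  proof -
    have "root g (r ^ t) < root g (2 ^ g)"
      using tg by (intro real_root_less_mono)
    then show ?thesis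
      using tg(1) by (simp add: real_root_power_cancel)
  qed
  define \<epsilon>' where "\<epsilon>' = 2 - root g (r ^ t)"
  have \<epsilon>': "0 < \<epsilon>'" "2 - \<epsilon>' = root g (r ^ t)"
    using root by (auto simp: \<epsilon>'_def)
  then obtain k where k: "\<not> (\<exists>prog (c::nat) (d::nat). \<forall>n \<phi>. ksat_instance k n \<phi> \<longrightarrow>
    decides_within prog (enc_cnf n \<phi>) (cnf_satisfiable \<phi>) (root g (r ^ t) ^ n * (real c * real (n + 1) ^ d)))"
    using assms(3) unfolding SETH_def by metis
  define \<sigma> where "\<sigma> = 4 * (k * t) + 1"
  define \<delta> where "\<delta> = q + k * t"
  have "\<not> (\<exists>prog (c::nat) (d::nat). \<forall>n E Q p.
    simple_graph {..<n} E \<and> is_hub \<sigma> \<delta> {..<n} E Q \<and> card Q \<le> p \<longrightarrow>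
      decides_within prog (enc_graph_hub n E Q) (colorable q {..<n} E)
        ((real q - \<epsilon>) ^ p * (real c * real (n + 1) ^ d)))"
  proof
    assume "\<exists>prog (c::nat) (d::nat). \<forall>n E Q p.
      simple_graph {..<n} E \<and> is_hub \<sigma> \<delta> {..<n} E Q \<and> card Q \<le> p \<longrightarrow>
        decides_within prog (enc_graph_hub n E Q) (colorable q {..<n} E)
          ((real q - \<epsilon>) ^ p * (real c * real (n + 1) ^ d))"
    then obtain prog c d where "\<forall>n E Q p.
      simple_graph {..<n} E \<and> is_hub \<sigma> \<delta> {..<n} E Q \<and> card Q \<le> p \<longrightarrow>
        decides_within prog (enc_graph_hub n E Q) (colorable q {..<n} E)
          ((real q - \<epsilon>) ^ p * (real c * real (n + 1) ^ d))"
      by (elim exE)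
    then have alg: "decides_within prog (enc_graph_hub n E Q) (colorable q {..<n} E)
        ((real q - \<epsilon>) ^ p * (real c * real (n + 1) ^ d))"
      if "simple_graph {..<n} E" "is_hub \<sigma> \<delta> {..<n} E Q" "card Q \<le> p" for n E Q p
      using that by simp
    \<comment> \<open>The bound is absurd for the empty graph and \<open>p = 1\<close> unless the base is positive.\<close>
    have pos: "0 < real q - \<epsilon>"
    proof (rule ccontr)
      assume "\<not> 0 < real q - \<epsilon>"
      have "simple_graph {..<0 :: nat} {}" "is_hub \<sigma> \<delta> {..<0 :: nat} {} {}"
        by (auto simp: simple_graph_def is_hub_def components_on_def sym_def irrefl_def)
      from alg[OF this, of 1] obtain t where "1 \<le> t" "real t \<le> (real q - \<epsilon>) * real c"
        unfolding decides_within_def by (auto dest: exec_time_pos)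
      moreover have "(real q - \<epsilon>) * real c \<le> 0"
        using \<open>\<not> 0 < real q - \<epsilon>\<close> by (intro mult_nonpos_nonneg) auto
      ultimately show False by linarith
    qed
    have "decides_within prog (enc_graph_hub n E Q) (colorable q {..<n} E) (r ^ p * (real c * real (n + 1) ^ d))"
      if "simple_graph {..<n} E" "is_hub \<sigma> \<delta> {..<n} E Q" "card Q \<le> p" for n E Q p
    proof -
      have "(real q - \<epsilon>) ^ p * (real c * real (n + 1) ^ d) \<le> r ^ p * (real c * real (n + 1) ^ d)"
        using pos by (intro mult_right_mono power_mono) (auto simp: r_def)
      with alg[OF that] show ?thesis
        unfolding decides_within_def by (meson order_trans)
    qed
    from ksat_from_coloring[OF r this[unfolded \<sigma>_def \<delta>_def]] k show False
      by (rule notE[rotated])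
  qed
  moreover have "1 \<le> \<sigma>" "1 \<le> \<delta>"
    using assms(1) by (auto simp: \<sigma>_def \<delta>_def)
  ultimately show ?thesis by blast
qed

theorem theorem1p2:
  fixes q :: nat
  assumes "q \<ge> 3"
  shows "(\<forall>\<sigma> \<ge> 1. \<forall>\<delta> \<ge> 1. \<exists>prog (c::nat) (d::nat). \<forall>n E Q p.
           simple_graph {..<n} E \<and> is_hub \<sigma> \<delta> {..<n} E Q \<and> card Q = p \<longrightarrow>
             decides_within prog (enc_graph_hub n E Q) (colorable q {..<n} E)
               (real q ^ p * (real c * real (n + 1) ^ d)))
       \<and> (\<forall>\<epsilon>::real. \<epsilon> > 0 \<longrightarrow> (\<exists>\<sigma> \<ge> 1. \<exists>\<delta> \<ge> 1.
           (\<exists>prog (c::nat) (d::nat). \<forall>n E Q p.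
              simple_graph {..<n} E \<and> is_hub \<sigma> \<delta> {..<n} E Q \<and> card Q \<le> p \<longrightarrow>
                decides_within prog (enc_graph_hub n E Q) (colorable q {..<n} E)
                  ((real q - \<epsilon>) ^ p * (real c * real (n + 1) ^ d)))
           \<longrightarrow> \<not> SETH))"
proof (intro conjI allI impI)
  show "\<exists>prog (c::nat) (d::nat). \<forall>n E Q p.
      simple_graph {..<n} E \<and> is_hub \<sigma> \<delta> {..<n} E Q \<and> card Q = p \<longrightarrow>
        decides_within prog (enc_graph_hub n E Q) (colorable q {..<n} E)
          (real q ^ p * (real c * real (n + 1) ^ d))" for \<sigma> \<delta>
    using assms by (intro coloring_algorithm) simp
  fix \<epsilon> :: real assume "\<epsilon> > 0"
  show "\<exists>\<sigma> \<ge> 1. \<exists>\<delta> \<ge> 1.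
      (\<exists>prog (c::nat) (d::nat). \<forall>n E Q p.
         simple_graph {..<n} E \<and> is_hub \<sigma> \<delta> {..<n} E Q \<and> card Q \<le> p \<longrightarrow>
           decides_within prog (enc_graph_hub n E Q) (colorable q {..<n} E)
             ((real q - \<epsilon>) ^ p * (real c * real (n + 1) ^ d)))
      \<longrightarrow> \<not> SETH"
  proof (cases SETH)
    case True
    from coloring_lower_bound[OF assms \<open>\<epsilon> > 0\<close> True] show ?thesis
      by (elim exE conjE) (intro exI conjI impI; assumption?; erule (1) notE)
  qed auto
qed

end
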